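(* Every second-order algebraic theory $T:\mathbb{M}\to\mathbb{T}$ is isomorphic, in the category $\mathcal{SOAT}$, to the second-order algebraic theory $\mathbb{M}\to\mathbb{M}(\mathcal{E}(T))$ of its associated equational presentation (internal language) $\mathcal{E}(T)$.
   Context: Syntax. A (unityped second-order) signature $\Sigma$ is a set of operators each with an arity $\mathsf{o}:\langle n_1,\dots,n_k\rangle\in\mathbb{N}^*$ ($k$ arguments, the $i$-th binding $n_i$ variables). Terms $\Theta\rhd\Gamma\vdash t$, in a context of metavariables $\Theta=(\mathsf{m}_1:[m_1],\dots,\mathsf{m}_k:[m_k])$ with natural-number arities and variables $\Gamma$, are generated by: $x\in\Gamma$; $\mathsf{m}[t_1,\dots,t_m]$ for $(\mathsf{m}:[m])\in\Theta$ and $t_i$ in context $\Theta\rhd\Gamma$; $\mathsf{o}((\vec x_1)t_1,\dots,(\vec x_k)t_k)$ with $\Theta\rhd\Gamma,\vec x_i\vdash t_i$, $|\vec x_i|=n_i$, $\vec x_i$ bound in $t_i$; modulo $\alpha$-equivalence. Metasubstitution: for $\mathsf{m}_1:[m_1],\dots,\mathsf{m}_k:[m_k]\rhd\Gamma\vdash t$ and $\Theta\rhd\Gamma,\vec x_i\vdash t_i$ ($|\vec x_i|=m_i$), $t\{\mathsf{m}_i:=(\vec x_i)t_i\}_i$ is defined by $x\mapsto x$, $\mathsf{m}_\ell[s_1,\dots,s_{m_\ell}]\mapsto t_\ell[s'_j/x_{\ell,j}]_j$ (capture-avoiding substitution, $s'_j$ the metasubstituted $s_j$), and commuting with operators. A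 second-order equational presentation $(\Sigma,E)$ is a signature with a set $E$ of axioms $\Theta\rhd\Gamma\vdash s\equiv t$; second-order equational logic derives judgements from: the axioms; reflexivity, symmetry, transitivity; and from $\mathsf{m}_1:[m_1],\dots,\mathsf{m}_k:[m_k]\rhd\Gamma\vdash s\equiv t$ and $\Theta\rhd\Delta,\vec x_i\vdash s_i\equiv t_i$ ($|\vec x_i|=m_i$) infer $\Theta\rhd\Gamma,\Delta\vdash s\{\mathsf{m}_i:=(\vec x_i)s_i\}\equiv t\{\mathsf{m}_i:=(\vec x_i)t_i\}$. $\mathbb{M}$: objects $\mathbb{N}^*$; morphisms $\langle m_1,\dots,m_k\rangle\to\langle n_1,\dots,n_\ell\rangle$ are tuples $\langle t_1,\dots,t_\ell\rangle$ of terms over the empty signature, $t_i$ in context $\mathsf{m}_1:[m_1],\dots,\mathsf{m}_k:[m_k]\rhd x_1,\dots,x_{n_i}$; identities $\langle\mathsf{m}_i[x_1,\dots,x_{m_i}]\rangle_i$; composite of $\langle s_p\rangle_{p\le j}:\langle l_1,\dots,l_i\rangle\to\langle m_1,\dots,m_j\rangle$ then $\langle t_q\rangle_q$ is $\langle t_q\{\mathsf{m}_p:=(x_1,\dots,x_{m_p})s_p\}_p\rangle_q$. $\mathbb{M}$ is strict cartesian (products by concatenation) and $\langle0\rangle$ is exponentiable with $\langle0\rangle\Rightarrow\langle m_1,\dots,m_k\rangle=\langle m_1+1,\dots,m_k+1\rangle$ and evaluation $\langle\mathsf{m}_i[x_1,\dots,x_{m_i},\mathsf{m}_{k+1}[\,]]\rangle_{i\le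 k}$. For a presentation $\mathcal{E}$, $\mathbb{M}(\mathcal{E})$ is defined like $\mathbb{M}$ but with terms over $\Sigma$ taken modulo derivable equality from $E$, with the canonical identity-on-objects functor $\mathbb{M}\to\mathbb{M}(\mathcal{E})$. A second-order algebraic theory is a cartesian category $\mathbb{T}$ with a strict cartesian identity-on-objects functor $T:\mathbb{M}\to\mathbb{T}$ preserving the exponentiable object $\langle0\rangle$. An algebraic translation $T\to T'$ (for $T':\mathbb{M}\to\mathbb{T}'$) is a functor $F:\mathbb{T}\to\mathbb{T}'$ with $T'=F\circ T$; $\mathcal{SOAT}$ is the resulting category. Internal language $\mathcal{E}(T)$: for every $f:\langle m_1,\dots,m_k\rangle\to\langle n\rangle$ in $\mathbb{T}$ an operator $\mathsf{o}_f$ of arity $\langle m_1,\dots,m_k,0,\dots,0\rangle$ ($n$ zeros); with $\mathsf{t}_f=\mathsf{o}_f((x_1,\dots,x_{m_1})\mathsf{m}_1[x_1,\dots,x_{m_1}],\dots,(x_1,\dots,x_{m_k})\mathsf{m}_k[x_1,\dots,x_{m_k}],x_1,\dots,x_n)$ in context $\mathsf{m}_1:[m_1],\dots,\mathsf{m}_k:[m_k]\rhd x_1,\dots,x_n$, the axioms are $s\equiv\mathsf{t}_{T\langle s\rangle}$ for every $\langle s\rangle:\langle m_1,\dots,m_k\rangle\to\langle n\rangle$ in $\mathbb{M}$, and $\mathsf{t}_h\equiv\mathsf{t}_g\{\mathsf{m}_i:=(x_1,\dots,x_{n_i})\mathsf{t}_{f_i}\}_{i\le\ell}$ whenever $h=g\circ\langle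 f_1,\dots,f_\ell\rangle$ in $\mathbb{T}$ with $h:\langle m_1,\dots,m_k\rangle\to\langle n\rangle$, $g:\langle n_1,\dots,n_\ell\rangle\to\langle n\rangle$, $f_i:\langle m_1,\dots,m_k\rangle\to\langle n_i\rangle$. *)

theory Defs
  imports Main
begin

text \<open>Categories are given by families of hom-sets, which need not be disjoint; hence composition,
  and the action of a functor on morphisms, take the objects involved as arguments.
  \<^term>\<open>Cmp C A B D g f\<close> is the composite of \<^term>\<open>f \<in> Hom C A B\<close> followed by
  \<^term>\<open>g \<in> Hom C B D\<close>.\<close>

record ('o, 'a) cat =
  Obj :: "'o set"
  Hom :: "'o \<Rightarrow> 'o \<Rightarrow> 'a set"
  Id  :: "'o \<Rightarrow> 'a"
  Cmp :: "'o \<Rightarrow> 'o \<Rightarrow> 'o \<Rightarrow> 'a \<Rightarrow> 'a \<Rightarrow> 'a"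

record ('o, 'a) ccat = "('o, 'a) cat" +
  One  :: 'o
  Prod :: "'o \<Rightarrow> 'o \<Rightarrow> 'o"
  Fst  :: "'o \<Rightarrow> 'o \<Rightarrow> 'a"
  Snd  :: "'o \<Rightarrow> 'o \<Rightarrow> 'a"

locale category =
  fixes C :: "('o, 'a, 'z) cat_scheme"
  assumes Id_in_Hom: "A \<in> Obj C \<Longrightarrow> Id C A \<in> Hom C A A"
    and Cmp_in_Hom:
      "\<lbrakk>A \<in> Obj C; B \<in> Obj C; D \<in> Obj C; f \<in> Hom C A B; g \<in> Hom C B D\<rbrakk>
        \<Longrightarrow> Cmp C A B D g f \<in> Hom C A D"
    and Cmp_Id_right:
      "\<lbrakk>A \<in> Obj C; B \<in> Obj C; f \<in> Hom C A B\<rbrakk> \<Longrightarrow> Cmp C A A B f (Id C A) = f"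
    and Cmp_Id_left:
      "\<lbrakk>A \<in> Obj C; B \<in> Obj C; f \<in> Hom C A B\<rbrakk> \<Longrightarrow> Cmp C A B B (Id C B) f = f"
    and Cmp_assoc:
      "\<lbrakk>A \<in> Obj C; B \<in> Obj C; D \<in> Obj C; E \<in> Obj C;
        f \<in> Hom C A B; g \<in> Hom C B D; h \<in> Hom C D E\<rbrakk>
        \<Longrightarrow> Cmp C A D E h (Cmp C A B D g f) = Cmp C A B E (Cmp C B D E h g) f"

locale cartesian_category = category C
  for C :: "('o, 'a, 'z) ccat_scheme" +
  assumes One_Obj: "One C \<in> Obj C"
    and One_terminal: "A \<in> Obj C \<Longrightarrow> \<exists>!f. f \<in> Hom C A (One C)"
    and Prod_Obj: "\<lbrakk>A \<in> Obj C; B \<in> Obj C\<rbrakk> \<Longrightarrow> Prod C A B \<in> Obj C"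
    and Fst_in_Hom: "\<lbrakk>A \<in> Obj C; B \<in> Obj C\<rbrakk> \<Longrightarrow> Fst C A B \<in> Hom C (Prod C A B) A"
    and Snd_in_Hom: "\<lbrakk>A \<in> Obj C; B \<in> Obj C\<rbrakk> \<Longrightarrow> Snd C A B \<in> Hom C (Prod C A B) B"
    and Prod_universal:
      "\<lbrakk>X \<in> Obj C; A \<in> Obj C; B \<in> Obj C; f \<in> Hom C X A; g \<in> Hom C X B\<rbrakk>
        \<Longrightarrow> \<exists>!h. h \<in> Hom C X (Prod C A B)
              \<and> Cmp C X (Prod C A B) A (Fst C A B) h = f
              \<and> Cmp C X (Prod C A B) B (Snd C A B) h = g"

definition pairing :: "('o, 'a, 'z) ccat_scheme \<Rightarrow> 'o \<Rightarrow> 'o \<Rightarrow> 'o \<Rightarrow> 'a \<Rightarrow> 'a \<Rightarrow> 'a" where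
  "pairing C X A B f g =
    (THE h. h \<in> Hom C X (Prod C A B)
          \<and> Cmp C X (Prod C A B) A (Fst C A B) h = f
          \<and> Cmp C X (Prod C A B) B (Snd C A B) h = g)"

text \<open>\<^term>\<open>is_exponential C X A E ev\<close>: the object \<^term>\<open>E\<close> with evaluation
  \<^term>\<open>ev \<in> Hom C (Prod C E X) A\<close> is an exponential of \<^term>\<open>A\<close> by \<^term>\<open>X\<close>.\<close>

definition is_exponential :: "('o, 'a, 'z) ccat_scheme \<Rightarrow> 'o \<Rightarrow> 'o \<Rightarrow> 'o \<Rightarrow> 'a \<Rightarrow> bool" where
  "is_exponential C X A E ev \<longleftrightarrow>
     X \<in> Obj C \<and> A \<in> Obj C \<and> E \<in> Obj C \<and> ev \<in> Hom C (Prod C E X) A \<and>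
     (\<forall>B \<in> Obj C. \<forall>f \<in> Hom C (Prod C B X) A. \<exists>!g. g \<in> Hom C B E \<and>
        Cmp C (Prod C B X) (Prod C E X) A ev
          (pairing C (Prod C B X) E X
             (Cmp C (Prod C B X) B E g (Fst C B X)) (Snd C B X)) = f)"

record ('o1, 'a1, 'o2, 'a2) func =
  fobj :: "'o1 \<Rightarrow> 'o2"
  farr :: "'o1 \<Rightarrow> 'o1 \<Rightarrow> 'a1 \<Rightarrow> 'a2"

locale cat_functor = dom: category C + cod: category D
  for C :: "('o1, 'a1, 'z1) cat_scheme"
    and D :: "('o2, 'a2, 'z2) cat_scheme"
    and F :: "('o1, 'a1, 'o2, 'a2) func" +
  assumes fobj_Obj: "A \<in> Obj C \<Longrightarrow> fobj F A \<in> Obj D"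
    and farr_in_Hom:
      "\<lbrakk>A \<in> Obj C; B \<in> Obj C; f \<in> Hom C A B\<rbrakk> \<Longrightarrow> farr F A B f \<in> Hom D (fobj F A) (fobj F B)"
    and farr_Id: "A \<in> Obj C \<Longrightarrow> farr F A A (Id C A) = Id D (fobj F A)"
    and farr_Cmp:
      "\<lbrakk>A \<in> Obj C; B \<in> Obj C; E \<in> Obj C; f \<in> Hom C A B; g \<in> Hom C B E\<rbrakk>
        \<Longrightarrow> farr F A E (Cmp C A B E g f)
           = Cmp D (fobj F A) (fobj F B) (fobj F E) (farr F B E g) (farr F A B f)"

definition id_func :: "('o, 'a, 'o, 'a) func" where
  "id_func = \<lparr>fobj = (\<lambda>A. A), farr = (\<lambda>A B f. f)\<rparr>"

definition comp_func ::
  "('o2, 'a2, 'o3, 'a3) func \<Rightarrow> ('o1, 'a1, 'o2, 'a2) func \<Rightarrow> ('o1, 'a1, 'o3, 'a3) func" where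
  "comp_func G F =
     \<lparr>fobj = (\<lambda>A. fobj G (fobj F A)),
      farr = (\<lambda>A B f. farr G (fobj F A) (fobj F B) (farr F A B f))\<rparr>"

text \<open>Equality of functors with domain \<^term>\<open>C\<close>; values outside of \<^term>\<open>C\<close> are irrelevant.\<close>

definition func_eq ::
  "('o1, 'a1, 'z) cat_scheme \<Rightarrow> ('o1, 'a1, 'o2, 'a2) func \<Rightarrow> ('o1, 'a1, 'o2, 'a2) func \<Rightarrow> bool" where
  "func_eq C F G \<longleftrightarrow>
     (\<forall>A \<in> Obj C. fobj F A = fobj G A) \<and>
     (\<forall>A \<in> Obj C. \<forall>B \<in> Obj C. \<forall>f \<in> Hom C A B. farr F A B f = farr G A B f)"

locale strict_cartesian_functor =
  cat_functor C D F + dom: cartesian_category C + cod: cartesian_category D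
  for C :: "('o1, 'a1, 'z1) ccat_scheme"
    and D :: "('o2, 'a2, 'z2) ccat_scheme"
    and F :: "('o1, 'a1, 'o2, 'a2) func" +
  assumes fobj_One: "fobj F (One C) = One D"
    and fobj_Prod:
      "\<lbrakk>A \<in> Obj C; B \<in> Obj C\<rbrakk> \<Longrightarrow> fobj F (Prod C A B) = Prod D (fobj F A) (fobj F B)"
    and farr_Fst:
      "\<lbrakk>A \<in> Obj C; B \<in> Obj C\<rbrakk>
        \<Longrightarrow> farr F (Prod C A B) A (Fst C A B) = Fst D (fobj F A) (fobj F B)"
    and farr_Snd:
      "\<lbrakk>A \<in> Obj C; B \<in> Obj C\<rbrakk>
        \<Longrightarrow> farr F (Prod C A B) B (Snd C A B) = Snd D (fobj F A) (fobj F B)"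

record 'c signature =
  Ops :: "'c set"
  Ar  :: "'c \<Rightarrow> nat list"

text \<open>Terms modulo alpha-equivalence, with de Bruijn indices for variables and positions in the
  metavariable context for metavariables. A pair \<open>(k, t)\<close> stands for the abstraction
  \<open>(x\<^sub>1, \<dots>, x\<^sub>k) t\<close>. A variable context is represented by its length. In a context
  \<open>\<Gamma>, x\<^sub>1, \<dots>, x\<^sub>k\<close> the variable \<open>x\<^sub>j\<close> is \<open>Var (j - 1)\<close>, and the indices of the
  variables of \<open>\<Gamma>\<close> are shifted by \<open>k\<close>.\<close>

datatype 'c tm =
    Var nat
  | MVar nat "'c tm list"
  | Op 'c "(nat \<times> 'c tm) list"

inductive wf_tm :: "('c, 'z) signature_scheme \<Rightarrow> nat list \<Rightarrow> nat \<Rightarrow> 'c tm \<Rightarrow> bool"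
  for S :: "('c, 'z) signature_scheme" and \<Theta> :: "nat list" where
  wf_Var: "i < n \<Longrightarrow> wf_tm S \<Theta> n (Var i)"
| wf_MVar: "\<lbrakk>l < length \<Theta>; length ss = \<Theta> ! l; \<forall>s \<in> set ss. wf_tm S \<Theta> n s\<rbrakk>
    \<Longrightarrow> wf_tm S \<Theta> n (MVar l ss)"
| wf_Op: "\<lbrakk>c \<in> Ops S; map fst bs = Ar S c; \<forall>k t. (k, t) \<in> set bs \<longrightarrow> wf_tm S \<Theta> (n + k) t\<rbrakk>
    \<Longrightarrow> wf_tm S \<Theta> n (Op c bs)"

definition lift_ren :: "nat \<Rightarrow> (nat \<Rightarrow> nat) \<Rightarrow> nat \<Rightarrow> nat" where
  "lift_ren k \<rho> i = (if i < k then i else \<rho> (i - k) + k)"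

fun ren :: "(nat \<Rightarrow> nat) \<Rightarrow> 'c tm \<Rightarrow> 'c tm" where
  "ren \<rho> (Var i) = Var (\<rho> i)"
| "ren \<rho> (MVar l ss) = MVar l (map (ren \<rho>) ss)"
| "ren \<rho> (Op c bs) = Op c (map (\<lambda>(k, t). (k, ren (lift_ren k \<rho>) t)) bs)"

definition lift_sub :: "nat \<Rightarrow> (nat \<Rightarrow> 'c tm) \<Rightarrow> nat \<Rightarrow> 'c tm" where
  "lift_sub k \<sigma> i = (if i < k then Var i else ren (\<lambda>j. j + k) (\<sigma> (i - k)))"

fun sub :: "(nat \<Rightarrow> 'c tm) \<Rightarrow> 'c tm \<Rightarrow> 'c tm" where
  "sub \<sigma> (Var i) = \<sigma> i"
| "sub \<sigma> (MVar l ss) = MVar l (map (sub \<sigma>) ss)"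
| "sub \<sigma> (Op c bs) = Op c (map (\<lambda>(k, t). (k, sub (lift_sub k \<sigma>) t)) bs)"

text \<open>\<open>inst (m, t) [s\<^sub>1, \<dots>, s\<^sub>m]\<close> is \<open>t[s\<^sub>j/x\<^sub>j]\<^sub>j\<close>.\<close>

definition inst :: "nat \<times> 'c tm \<Rightarrow> 'c tm list \<Rightarrow> 'c tm" where
  "inst b ss = (case b of (m, t) \<Rightarrow> sub (\<lambda>j. if j < m then ss ! j else Var (j - m)) t)"

text \<open>Weakening of an abstraction from \<open>\<Gamma>\<close> to \<open>\<Gamma>, y\<^sub>1, \<dots>, y\<^sub>k\<close>.\<close>

definition weaken_abs :: "nat \<Rightarrow> nat \<times> 'c tm \<Rightarrow> nat \<times> 'c tm" where
  "weaken_abs k b = (case b of (m, t) \<Rightarrow> (m, ren (lift_ren m (\<lambda>j. j + k)) t))"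

fun msub :: "(nat \<times> 'c tm) list \<Rightarrow> 'c tm \<Rightarrow> 'c tm" where
  "msub \<tau> (Var i) = Var i"
| "msub \<tau> (MVar l ss) = inst (\<tau> ! l) (map (msub \<tau>) ss)"
| "msub \<tau> (Op c bs) = Op c (map (\<lambda>(k, t). (k, msub (map (weaken_abs k) \<tau>) t)) bs)"

text \<open>An axiom \<open>(\<Theta>, n, s, t)\<close> is the equation \<open>\<Theta> \<rhd> x\<^sub>1, \<dots>, x\<^sub>n \<turnstile> s \<equiv> t\<close>.\<close>

record 'c presentation = "'c signature" +
  Axioms :: "(nat list \<times> nat \<times> 'c tm \<times> 'c tm) set"

text \<open>In the last rule \<open>g\<close> and \<open>d\<close> are the lengths of \<open>\<Gamma>\<close> and \<open>\<Delta>\<close>; the renaming weakens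
  \<open>s\<close> and \<open>t\<close> from \<open>\<Gamma>\<close> to \<open>\<Gamma>, \<Delta>\<close>. The weakening of \<open>s\<^sub>i\<close> and \<open>t\<^sub>i\<close> from
  \<open>\<Delta>, x\<^sub>1, \<dots>, x\<^sub>m\<close> to \<open>\<Gamma>, \<Delta>, x\<^sub>1, \<dots>, x\<^sub>m\<close> is the identity on de Bruijn indices.\<close>

inductive derivable ::
  "('c, 'z) presentation_scheme \<Rightarrow> nat list \<Rightarrow> nat \<Rightarrow> 'c tm \<Rightarrow> 'c tm \<Rightarrow> bool"
  for P :: "('c, 'z) presentation_scheme" where
  axiom: "(\<Theta>, n, s, t) \<in> Axioms P \<Longrightarrow> derivable P \<Theta> n s t"
| refl: "wf_tm P \<Theta> n t \<Longrightarrow> derivable P \<Theta> n t t"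
| sym: "derivable P \<Theta> n s t \<Longrightarrow> derivable P \<Theta> n t s"
| trans: "\<lbrakk>derivable P \<Theta> n s t; derivable P \<Theta> n t u\<rbrakk> \<Longrightarrow> derivable P \<Theta> n s u"
| msubst: "\<lbrakk>derivable P ms g s t; length ss = length ms; length ts = length ms;
     \<forall>i < length ms. derivable P \<Theta> (d + ms ! i) (ss ! i) (ts ! i)\<rbrakk>
    \<Longrightarrow> derivable P \<Theta> (g + d)
          (msub (zip ms ss) (ren (\<lambda>j. j + d) s)) (msub (zip ms ts) (ren (\<lambda>j. j + d) t))"

text \<open>\<open>eta_mvar l m\<close> is \<open>m\<^sub>l[x\<^sub>1, \<dots>, x\<^sub>m]\<close>, with metavariables counted from 0.\<close>

definition eta_mvar :: "nat \<Rightarrow> nat \<Rightarrow> 'c tm" where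
  "eta_mvar l m = MVar l (map Var [0..<m])"

definition empty_sig :: "unit signature" where
  "empty_sig = \<lparr>Ops = {}, Ar = (\<lambda>_. [])\<rparr>"

definition MM :: "(nat list, unit tm list) ccat" where
  "MM =
    \<lparr>Obj = UNIV,
     Hom = (\<lambda>ms ns. {ts. length ts = length ns \<and>
                          (\<forall>i < length ns. wf_tm empty_sig ms (ns ! i) (ts ! i))}),
     Id = (\<lambda>ms. map (\<lambda>i. eta_mvar i (ms ! i)) [0..<length ms]),
     Cmp = (\<lambda>ls ms ns ts ss. map (msub (zip ms ss)) ts),
     One = [],
     Prod = (\<lambda>ms ns. ms @ ns),
     Fst = (\<lambda>ms ns. map (\<lambda>i. eta_mvar i (ms ! i)) [0..<length ms]),
     Snd = (\<lambda>ms ns. map (\<lambda>i. eta_mvar (length ms + i) (ns ! i)) [0..<length ns])\<rparr>"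

definition MM_exp :: "nat list \<Rightarrow> nat list" where
  "MM_exp ms = map Suc ms"

definition MM_ev :: "nat list \<Rightarrow> unit tm list" where
  "MM_ev ms =
     map (\<lambda>i. MVar i (map Var [0..<ms ! i] @ [MVar (length ms) []])) [0..<length ms]"

definition identity_on_objects ::
  "('o, 'a1, 'z1) cat_scheme \<Rightarrow> ('o, 'a2, 'z2) cat_scheme \<Rightarrow> ('o, 'a1, 'o, 'a2) func \<Rightarrow> bool" where
  "identity_on_objects C D F \<longleftrightarrow> Obj D = Obj C \<and> (\<forall>A \<in> Obj C. fobj F A = A)"

definition preserves_MM_exponentials ::
  "('o, 'a, 'z) ccat_scheme \<Rightarrow> (nat list, unit tm list, 'o, 'a) func \<Rightarrow> bool" where
  "preserves_MM_exponentials D F \<longleftrightarrow>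
     (\<forall>ms. is_exponential D (fobj F [0]) (fobj F ms) (fobj F (MM_exp ms))
             (farr F (Prod MM (MM_exp ms) [0]) ms (MM_ev ms)))"

definition soat ::
  "(nat list, 'a, 'z) ccat_scheme \<Rightarrow> (nat list, unit tm list, nat list, 'a) func \<Rightarrow> bool" where
  "soat D T \<longleftrightarrow>
     strict_cartesian_functor MM D T \<and> identity_on_objects MM D T \<and> preserves_MM_exponentials D T"

definition algebraic_translation ::
  "(nat list, 'a1, 'z1) ccat_scheme \<Rightarrow> (nat list, unit tm list, nat list, 'a1) func \<Rightarrow>
   (nat list, 'a2, 'z2) ccat_scheme \<Rightarrow> (nat list, unit tm list, nat list, 'a2) func \<Rightarrow>
   (nat list, 'a1, nat list, 'a2) func \<Rightarrow> bool" where
  "algebraic_translation D T D' T' F \<longleftrightarrow>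
     soat D T \<and> soat D' T' \<and> cat_functor D D' F \<and> func_eq MM T' (comp_func F T)"

definition soat_isomorphic ::
  "(nat list, 'a1, 'z1) ccat_scheme \<Rightarrow> (nat list, unit tm list, nat list, 'a1) func \<Rightarrow>
   (nat list, 'a2, 'z2) ccat_scheme \<Rightarrow> (nat list, unit tm list, nat list, 'a2) func \<Rightarrow> bool" where
  "soat_isomorphic D T D' T' \<longleftrightarrow>
     (\<exists>F G. algebraic_translation D T D' T' F \<and> algebraic_translation D' T' D T G \<and>
            func_eq D (comp_func G F) id_func \<and> func_eq D' (comp_func F G) id_func)"

text \<open>Terms over the empty signature contain no operators, so the function mapped is irrelevant.\<close>

definition embed :: "unit tm \<Rightarrow> 'c tm" where
  "embed = map_tm (\<lambda>_. undefined)"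

definition eq_class ::
  "('c, 'z) presentation_scheme \<Rightarrow> nat list \<Rightarrow> nat \<Rightarrow> 'c tm \<Rightarrow> 'c tm set" where
  "eq_class P \<Theta> n t = {u. derivable P \<Theta> n t u}"

definition canonical_arr ::
  "('c, 'z) presentation_scheme \<Rightarrow> nat list \<Rightarrow> nat list \<Rightarrow> unit tm list \<Rightarrow> 'c tm set list" where
  "canonical_arr P ms ns ts = map2 (\<lambda>n t. eq_class P ms n (embed t)) ns ts"

text \<open>Morphisms are tuples of equivalence classes of terms. The composite consists of the classes of
  all metasubstitutions of representatives.\<close>

definition MM_of :: "('c, 'z) presentation_scheme \<Rightarrow> (nat list, 'c tm set list) ccat" where
  "MM_of P =
    \<lparr>Obj = UNIV,
     Hom = (\<lambda>ms ns. {ts. length ts = length ns \<and>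
              (\<forall>i < length ns. \<exists>t. wf_tm P ms (ns ! i) t \<and> ts ! i = eq_class P ms (ns ! i) t)}),
     Id = (\<lambda>ms. canonical_arr P ms ms (Id MM ms)),
     Cmp = (\<lambda>ls ms ns ts ss.
              map2 (\<lambda>n t. {u. \<exists>t' \<in> t. \<exists>ss' \<in> listset ss. derivable P ls n (msub (zip ms ss') t') u})
                ns ts),
     One = [],
     Prod = (\<lambda>ms ns. ms @ ns),
     Fst = (\<lambda>ms ns. canonical_arr P (ms @ ns) ms (Fst MM ms ns)),
     Snd = (\<lambda>ms ns. canonical_arr P (ms @ ns) ns (Snd MM ms ns))\<rparr>"

definition canonical ::
  "('c, 'z) presentation_scheme \<Rightarrow> (nat list, unit tm list, nat list, 'c tm set list) func" where
  "canonical P = \<lparr>fobj = (\<lambda>ms. ms), farr = canonical_arr P\<rparr>"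

text \<open>The tuple \<open>\<langle>f\<^sub>1, \<dots>, f\<^sub>l\<rangle>\<close> into \<open>\<langle>n\<^sub>1, \<dots>, n\<^sub>l\<rangle>\<close>, which is the product of the
  \<open>\<langle>n\<^sub>i\<rangle>\<close> with projections the images of the \<open>\<langle>m\<^sub>i[x\<^sub>1, \<dots>]\<rangle>\<close> under \<open>T\<close>.\<close>

definition tupling ::
  "(nat list, 'a, 'z) ccat_scheme \<Rightarrow> (nat list, unit tm list, nat list, 'a) func \<Rightarrow>
   nat list \<Rightarrow> nat list \<Rightarrow> 'a list \<Rightarrow> 'a" where
  "tupling D T ms ns fs =
     (THE p. p \<in> Hom D ms ns \<and>
        (\<forall>i < length ns. Cmp D ms ns [ns ! i] (farr T ns [ns ! i] [eta_mvar i (ns ! i)]) p = fs ! i))"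

text \<open>The operator \<open>o\<^sub>f\<close> for \<open>f : \<langle>m\<^sub>1, \<dots>, m\<^sub>k\<rangle> \<rightarrow> \<langle>n\<rangle>\<close> is the triple \<open>(ms, n, f)\<close>, because
  \<open>f\<close> may belong to several hom-sets. \<open>op_tm ms n f\<close> is the term \<open>t\<^sub>f\<close>.\<close>

definition op_tm :: "nat list \<Rightarrow> nat \<Rightarrow> 'a \<Rightarrow> (nat list \<times> nat \<times> 'a) tm" where
  "op_tm ms n f =
     Op (ms, n, f)
       (map (\<lambda>i. (ms ! i, eta_mvar i (ms ! i))) [0..<length ms] @ map (\<lambda>j. (0, Var j)) [0..<n])"

definition internal_language ::
  "(nat list, 'a, 'z) ccat_scheme \<Rightarrow> (nat list, unit tm list, nat list, 'a) func \<Rightarrow>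
   (nat list \<times> nat \<times> 'a) presentation" where
  "internal_language D T =
    \<lparr>Ops = {(ms, n, f). f \<in> Hom D ms [n]},
     Ar = (\<lambda>(ms, n, f). ms @ replicate n 0),
     Axioms =
       {(ms, n, embed s, op_tm ms n (farr T ms [n] [s])) | ms n s. [s] \<in> Hom MM ms [n]} \<union>
       {(ms, n, op_tm ms n h,
           msub (zip ns (map2 (op_tm ms) ns fs)) (op_tm ns n g)) | ms ns n g fs h.
          g \<in> Hom D ns [n] \<and> length fs = length ns \<and>
          (\<forall>i < length ns. fs ! i \<in> Hom D ms [ns ! i]) \<and>
          h \<in> Hom D ms [n] \<and> h = Cmp D ms ns [n] g (tupling D T ms ns fs)}\<rparr>"

end

theory Submission
  imports Defs
begin

text \<open>The functor sending \<open>f\<close> to the tuple of the classes of the terms \<open>t\<close> of its components is an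
  isomorphism, and the cartesian and exponential structure of \<open>\<M>(\<E>(T))\<close> is the one transported from
  \<open>D\<close> along it, so that none of it has to be verified syntactically.
  Preservation of composition and compatibility with \<open>T\<close> are the two groups of axioms.
  Faithfulness is soundness of an interpretation of terms in \<open>D\<close> by generalized elements, where
  binding is interpreted by the iterated exponential: elements of \<open>[k]\<close> at stage \<open>X\<close> are elements of
  \<open>[0]\<close> at stage \<open>X \<times> [0] \<times> \<dots> \<times> [0]\<close>. Fullness says that every term is derivably equal to some \<open>t\<^sub>f\<close>. The
  difficult case is an operator under free variables: these are first replaced by metavariables of
  arity 0, which reduces it to composition in \<open>D\<close>, and are recovered by abstraction.\<close>

section \<open>Renaming, substitution and metasubstitution\<close>

text \<open>The composition axioms speak of \<open>op_tm\<close> with its metavariables replaced by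
  terms \<open>op_tm\<close> whose variables are all bound at their place, whereas the arguments of
  an operator inside an arbitrary term also mention free variables. Metavariables of arity 0 can
  stand for these because the parameter context \<Delta> of \<open>msubst\<close> allows variables
  to be put back for them. Evaluation of an element of \<open>[n]\<close> at n arguments is the
  image under \<open>T\<close> of a term over the empty signature, the first metavariable applied to
  the others. Equations between evaluations therefore reduce to metasubstitution by functoriality of
  \<open>T\<close>; the universal property of the exponentials serves to give the unique existence
  of abstractions. Generalized elements at a stage are used, rather than arrows out of the
  metavariable context, because metasubstitution changes that context while the stage can stay
  fixed.\<close>

lemma lift_ren_simps [simp]:
  "i < k \<Longrightarrow> lift_ren k \<rho> i = i"
  "\<not> i < k \<Longrightarrow> lift_ren k \<rho> i = \<rho> (i - k) + k"
  by (simp_all add: lift_ren_def)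

lemma lift_sub_simps [simp]:
  "i < k \<Longrightarrow> lift_sub k \<sigma> i = Var i"
  "\<not> i < k \<Longrightarrow> lift_sub k \<sigma> i = ren (\<lambda>j. j + k) (\<sigma> (i - k))"
  by (simp_all add: lift_sub_def)

lemma sub_ren: "sub \<sigma> (ren \<rho> t) = sub (\<lambda>i. \<sigma> (\<rho> i)) t"
proof (induction \<rho> t arbitrary: \<sigma> rule: ren.induct)
  case (3 \<rho> c bs)
  have *: "lift_sub k \<sigma> (lift_ren k \<rho> i) = lift_sub k (\<lambda>i. \<sigma> (\<rho> i)) i" for k i
    by (cases "i < k") simp_all
  show ?case by (auto simp: * 3)
qed simp_all

lemma ren_id_on:
  assumes "wf_tm S \<Theta> n t" "\<And>i. i < n \<Longrightarrow> \<rho> i = i"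
  shows "ren \<rho> t = t"
  using assms
proof (induction arbitrary: \<rho> rule: wf_tm.induct)
  case (wf_MVar l ss n)
  then show ?case by (simp add: map_idI)
next
  case (wf_Op c bs n)
  have "ren (lift_ren k \<rho>) t = t" if "(k, t) \<in> set bs" for k t
  proof -
    have "lift_ren k \<rho> i = i" if "i < n + k" for i
      using that wf_Op.prems by (cases "i < k") simp_all
    then show ?thesis using wf_Op.IH that by blast
  qed
  then show ?case by (auto intro!: map_idI)
qed simp

lemma ren_closed [simp]: "wf_tm S \<Theta> 0 t \<Longrightarrow> ren \<rho> t = t"
  by (rule ren_id_on) auto

lemma ren_plus_0 [simp]: "ren (\<lambda>j. j + 0) t = t" "ren (\<lambda>j. j) t = t"
proof -
  have *: "lift_ren k (\<lambda>j. j) = (\<lambda>j. j)" for k by (auto simp: lift_ren_def)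
  have "ren \<rho> t = t" if "\<rho> = (\<lambda>j. j)" for \<rho>
    using that by (induction \<rho> t rule: ren.induct) (auto simp: * intro!: map_idI)
  then show "ren (\<lambda>j. j + 0) t = t" "ren (\<lambda>j. j) t = t" by simp_all
qed

lemma sub_id_on:
  assumes "wf_tm S \<Theta> n t" "\<And>i. i < n \<Longrightarrow> \<sigma> i = Var i"
  shows "sub \<sigma> t = t"
  using assms
proof (induction arbitrary: \<sigma> rule: wf_tm.induct)
  case (wf_MVar l ss n)
  then show ?case by (simp add: map_idI)
next
  case (wf_Op c bs n)
  have "sub (lift_sub k \<sigma>) t = t" if "(k, t) \<in> set bs" for k t
  proof -
    have "lift_sub k \<sigma> i = Var i" if "i < n + k" for i
      using that wf_Op.prems by (cases "i < k") simp_all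
    then show ?thesis using wf_Op.IH that by blast
  qed
  then show ?case by (auto intro!: map_idI)
qed simp

lemma sub_Var [simp]: "sub Var t = t"
proof -
  have *: "lift_sub k Var = Var" for k by (auto simp: lift_sub_def)
  have "sub \<sigma> t = t" if "\<sigma> = Var" for \<sigma> :: "nat \<Rightarrow> 'a tm"
    using that by (induction \<sigma> t rule: sub.induct) (auto simp: * intro!: map_idI)
  then show ?thesis by simp
qed

lemma ren_eta_mvar [simp]:
  "ren (lift_ren m \<rho>) (eta_mvar l m) = eta_mvar l m"
  by (simp add: eta_mvar_def)

lemma inst_eta_mvar [simp]: "length ss = m \<Longrightarrow> inst (m, eta_mvar l m) ss = MVar l ss"
  by (auto simp: inst_def eta_mvar_def intro: nth_equalityI)

text \<open>Free variables are raised by \<open>m\<close> and lowered again by \<open>inst\<close>;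
  bound ones are replaced by themselves. This is what happens to an abstraction put for a
  metavariable that is applied to exactly the variables bound around it.\<close>

lemma inst_weaken_abs_self [simp]:
  fixes t :: "'c tm"
  shows "inst (weaken_abs m (m, t)) (map Var [0..<m]) = t"
proof -
  have "(\<lambda>i. if lift_ren m (\<lambda>j. j + m) i < m then map Var [0..<m] ! lift_ren m (\<lambda>j. j + m) i
      else Var (lift_ren m (\<lambda>j. j + m) i - m)) = (Var :: nat \<Rightarrow> 'c tm)" by (auto simp: lift_ren_def)
  then show ?thesis unfolding inst_def weaken_abs_def sub_ren split by simp
qed

lemma inst_Vars [simp]: "wf_tm S \<Theta> m t \<Longrightarrow> inst (m, t) (map Var [0..<m]) = t"
  by (auto simp: inst_def intro: sub_id_on)

text \<open>All variables of \<open>t\<close> are bound by the abstraction, so weakening leaves it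
  alone whatever \<open>k\<close> is.\<close>

lemma inst_weaken_abs_Vars:
  assumes "wf_tm S \<Theta> m t"
  shows "inst (weaken_abs k (m, t)) (map Var [0..<m]) = t"
  by (auto simp: inst_def weaken_abs_def sub_ren intro!: sub_id_on[OF assms])

section \<open>Well-formedness under the operations on terms\<close>

lemma wf_ren:
  assumes "wf_tm S \<Theta> n t" "\<And>i. i < n \<Longrightarrow> \<rho> i < n'"
  shows "wf_tm S \<Theta> n' (ren \<rho> t)"
  using assms
proof (induction arbitrary: \<rho> n' rule: wf_tm.induct)
  case (wf_Op c bs n)
  have "wf_tm S \<Theta> (n' + k) (ren (lift_ren k \<rho>) t)" if "(k, t) \<in> set bs" for k t
  proof -
    have "lift_ren k \<rho> i < n' + k" if "i < n + k" for i
      using that wf_Op.prems[of "i - k"] by (cases "i < k") simp_all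
    then show ?thesis using wf_Op.IH that by blast
  qed
  with wf_Op.hyps show ?case
    by (auto intro!: wf_tm.wf_Op simp: comp_def case_prod_beta)
qed (auto intro!: wf_tm.intros)

lemma wf_mono: "wf_tm S \<Theta> n t \<Longrightarrow> n \<le> n' \<Longrightarrow> wf_tm S \<Theta> n' t"
  by (metis less_le_trans ren_plus_0(2) wf_ren)

lemma wf_sub:
  assumes "wf_tm S \<Theta> n t" "\<And>i. i < n \<Longrightarrow> wf_tm S \<Theta> n' (\<sigma> i)"
  shows "wf_tm S \<Theta> n' (sub \<sigma> t)"
  using assms
proof (induction arbitrary: \<sigma> n' rule: wf_tm.induct)
  case (wf_Op c bs n)
  have "wf_tm S \<Theta> (n' + k) (sub (lift_sub k \<sigma>) t)" if "(k, t) \<in> set bs" for k t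
  proof -
    have "wf_tm S \<Theta> (n' + k) (lift_sub k \<sigma> i)" if "i < n + k" for i
      using that wf_Op.prems[of "i - k"]
      by (cases "i < k") (auto intro: wf_tm.intros intro!: wf_ren[where n = n'])
    then show ?thesis using wf_Op.IH that by blast
  qed
  with wf_Op.hyps show ?case
    by (auto intro!: wf_tm.wf_Op simp: comp_def case_prod_beta)
qed (auto intro!: wf_tm.intros)

lemma wf_inst:
  assumes "wf_tm S \<Theta> (n + m) t" "length ss = m" "\<forall>s \<in> set ss. wf_tm S \<Theta> n s"
  shows "wf_tm S \<Theta> n (inst (m, t) ss)"
  unfolding inst_def using assms by (auto intro!: wf_sub[OF assms(1)] wf_tm.intros)

definition wf_abss :: "('c, 'z) signature_scheme \<Rightarrow> nat list \<Rightarrow> nat \<Rightarrow> nat list \<Rightarrow> (nat \<times> 'c tm) list \<Rightarrow> bool" where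
  "wf_abss S \<Theta> n ms \<tau> \<longleftrightarrow> length \<tau> = length ms \<and>
     (\<forall>l < length ms. fst (\<tau> ! l) = ms ! l \<and> wf_tm S \<Theta> (n + ms ! l) (snd (\<tau> ! l)))"

lemma wf_abss_weaken:
  assumes "wf_abss S \<Theta> n ms \<tau>"
  shows "wf_abss S \<Theta> (n + k) ms (map (weaken_abs k) \<tau>)"
  using assms
  by (auto simp: wf_abss_def weaken_abs_def case_prod_beta lift_ren_def intro!: wf_ren)

lemma wf_abss_zip:
  assumes "length ss = length ms" "\<And>i. i < length ms \<Longrightarrow> wf_tm S \<Theta> (n + ms ! i) (ss ! i)"
  shows "wf_abss S \<Theta> n ms (zip ms ss)"
  using assms by (simp add: wf_abss_def)

lemma wf_msub:
  assumes "wf_tm S ms n t" "wf_abss S \<Theta> n ms \<tau>"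
  shows "wf_tm S \<Theta> n (msub \<tau> t)"
  using assms
proof (induction arbitrary: \<tau> rule: wf_tm.induct)
  case (wf_MVar l ss n)
  then have "\<tau> ! l = (ms ! l, snd (\<tau> ! l))" "wf_tm S \<Theta> (n + ms ! l) (snd (\<tau> ! l))"
    by (auto simp: wf_abss_def prod_eq_iff)
  then have "wf_tm S \<Theta> n (inst (ms ! l, snd (\<tau> ! l)) (map (msub \<tau>) ss))"
    using wf_MVar by (intro wf_inst) auto
  then show ?case using \<open>\<tau> ! l = _\<close> by simp
next
  case (wf_Op c bs n)
  then show ?case
    by (auto intro!: wf_tm.wf_Op simp: comp_def case_prod_beta wf_abss_weaken)
qed (auto intro: wf_tm.intros)

lemma wf_eta_mvar: "l < length \<Theta> \<Longrightarrow> \<Theta> ! l = m \<Longrightarrow> m \<le> n \<Longrightarrow> wf_tm S \<Theta> n (eta_mvar l m)"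
  by (auto simp: eta_mvar_def intro!: wf_tm.intros)

lemma wf_append: "wf_tm S \<Theta> n t \<Longrightarrow> wf_tm S (\<Theta> @ \<Psi>) n t"
  by (induction rule: wf_tm.induct) (auto intro!: wf_tm.intros simp: nth_append)

text \<open>The identity metasubstitution. Without operators there are no binders, so
  \<open>\<tau>\<close> stays fixed in the induction.\<close>

lemma msub_eta_mvars:
  assumes "wf_tm empty_sig \<Theta> n s" 
    and "\<And>i. i < length \<Theta> \<Longrightarrow> \<tau> ! i = (\<Theta> ! i, eta_mvar i (\<Theta> ! i))"
  shows "msub \<tau> s = s"
  using assms by (induction) (auto intro: map_idI simp: empty_sig_def)

lemma embed_simps [simp]:
  "embed (Var i) = Var i"
  "embed (MVar l ss) = MVar l (map embed ss)"
  "embed (eta_mvar l m) = eta_mvar l m"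
  by (auto simp: embed_def eta_mvar_def)

lemma wf_embed: "wf_tm empty_sig \<Theta> n s \<Longrightarrow> wf_tm S \<Theta> n (embed s)"
  by (induction rule: wf_tm.induct) (auto intro!: wf_tm.intros simp: empty_sig_def)

text \<open>In \<open>op_tm\<close> every metavariable is applied to exactly the variables bound
  around it, so by \<open>inst_weaken_abs_self\<close> each \<open>ss ! i\<close> appears unchanged
  although it went under a binder.\<close>

lemma msub_op_tm:
  assumes "length ss = length ms"
  shows "msub (zip ms ss) (ren (\<lambda>j. j + d) (op_tm ms n f)) =
    Op (ms, n, f) (zip ms ss @ map (\<lambda>j. (0, Var (j + d))) [0..<n])"
proof -
  have [simp]: "map (\<lambda>x. Var (lift_ren m \<rho> x)) [0..<m] = map Var [0..<m]" for m \<rho>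
    by simp
  show ?thesis using assms
    by (auto simp: op_tm_def eta_mvar_def comp_def intro!: nth_equalityI)
qed

lemma derivable_msub:
  assumes "derivable P ms n s t" "length ss = length ms" "length ts = length ms"
    and "\<And>i. i < length ms \<Longrightarrow> derivable P \<Theta> (ms ! i) (ss ! i) (ts ! i)"
  shows "derivable P \<Theta> n (msub (zip ms ss) s) (msub (zip ms ts) t)"
  using derivable.msubst[OF assms(1-3), of \<Theta> 0] assms(4) by simp

section \<open>Products and exponentials in a second-order algebraic theory\<close>

lemma MM_simps [simp]:
  "Obj MM = UNIV"
  "Cmp MM ls ms ns ts ss = map (msub (zip ms ss)) ts"
  "One MM = []"
  "Prod MM ms ns = ms @ ns"
  by (simp_all add: MM_def)

lemma Id_MM: "Id MM ms = map (\<lambda>i. eta_mvar i (ms ! i)) [0..<length ms]"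
  by (simp add: MM_def)

lemma Fst_MM: "Fst MM ms ns = map (\<lambda>i. eta_mvar i (ms ! i)) [0..<length ms]"
  by (simp add: MM_def)

lemma Snd_MM: "Snd MM ms ns = map (\<lambda>i. eta_mvar (length ms + i) (ns ! i)) [0..<length ns]"
  by (simp add: MM_def)

lemma Hom_MM_iff:
  "ts \<in> Hom MM ms ns \<longleftrightarrow>
     length ts = length ns \<and> (\<forall>i < length ns. wf_tm empty_sig ms (ns ! i) (ts ! i))"
  by (simp add: MM_def)

lemma Hom_MM_single [simp]: "[t] \<in> Hom MM ms [n] \<longleftrightarrow> wf_tm empty_sig ms n t"
  by (simp add: Hom_MM_iff)

lemma map_upt_Cons: "map f [0..<Suc n] = f 0 # map (\<lambda>i. f (Suc i)) [0..<n]"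
  by (simp add: upt_conv_Cons map_Suc_upt[symmetric] comp_def del: upt_Suc)

lemma listset_iff: "xs \<in> listset As \<longleftrightarrow> length xs = length As \<and> (\<forall>i < length As. xs ! i \<in> As ! i)"
proof (induction As arbitrary: xs)
  case (Cons A As)
  then show ?case by (cases xs) (auto simp: set_Cons_def nth_Cons' less_Suc_eq_0_disj)
qed simp

locale second_order_theory =
  fixes D :: "(nat list, 'a) ccat"
    and T :: "(nat list, unit tm list, nat list, 'a) func"
  assumes soat: "soat D T"
begin

sublocale T: strict_cartesian_functor MM D T
  using soat by (simp add: soat_def)

lemma Obj_D [simp]: "Obj D = UNIV"
  and fobj_T [simp]: "fobj T ms = ms"
  using soat by (simp_all add: soat_def identity_on_objects_def)

lemma One_D [simp]: "One D = []" and Prod_D [simp]: "Prod D ms ns = ms @ ns"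
  using T.fobj_One T.fobj_Prod[of ms ns] by simp_all

lemmas Cmp_in_Hom = T.cod.Cmp_in_Hom[unfolded Obj_D, OF UNIV_I UNIV_I UNIV_I]
lemmas Cmp_assoc = T.cod.Cmp_assoc[unfolded Obj_D, OF UNIV_I UNIV_I UNIV_I UNIV_I]
lemmas Id_in_Hom = T.cod.Id_in_Hom[unfolded Obj_D, OF UNIV_I]
lemmas Cmp_Id_right = T.cod.Cmp_Id_right[unfolded Obj_D, OF UNIV_I UNIV_I]
lemmas Cmp_Id_left = T.cod.Cmp_Id_left[unfolded Obj_D, OF UNIV_I UNIV_I]
lemmas farr_in_Hom = T.farr_in_Hom[unfolded MM_simps fobj_T, OF UNIV_I UNIV_I]
lemmas farr_Cmp = T.farr_Cmp[unfolded MM_simps fobj_T, OF UNIV_I UNIV_I UNIV_I]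
lemmas farr_Fst = T.farr_Fst[unfolded MM_simps fobj_T, OF UNIV_I UNIV_I]
lemmas farr_Snd = T.farr_Snd[unfolded MM_simps fobj_T, OF UNIV_I UNIV_I]
lemmas farr_Id = T.farr_Id[unfolded MM_simps fobj_T, OF UNIV_I]

section \<open>Finite products of the objects \<open>[n]\<close>\<close>

definition proj :: "nat list \<Rightarrow> nat \<Rightarrow> 'a" where
  "proj ns i = farr T ns [ns ! i] [eta_mvar i (ns ! i)]"

lemma proj_in_Hom: "i < length ns \<Longrightarrow> n = ns ! i \<Longrightarrow> proj ns i \<in> Hom D ns [n]"
  unfolding proj_def by (auto intro!: farr_in_Hom wf_eta_mvar)

lemma proj_farr:
  assumes "ts \<in> Hom MM ms ns" "i < length ns"
  shows "Cmp D ms ns [ns ! i] (proj ns i) (farr T ms ns ts) = farr T ms [ns ! i] [ts ! i]"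
proof -
  have "msub (zip ns ts) (eta_mvar i (ns ! i)) = ts ! i"
    using assms by (auto simp: eta_mvar_def comp_def Hom_MM_iff)
  then show ?thesis
    unfolding proj_def using assms by (subst farr_Cmp[symmetric]) (auto intro!: wf_eta_mvar)
qed

lemma Fst_in_Hom: "Fst D ms ns \<in> Hom D (ms @ ns) ms"
  and Snd_in_Hom: "Snd D ms ns \<in> Hom D (ms @ ns) ns"
  using T.cod.Fst_in_Hom[of ms ns] T.cod.Snd_in_Hom[of ms ns] by simp_all

lemma proj_Fst:
  assumes "i < length ms"
  shows "Cmp D (ms @ ns) ms [ms ! i] (proj ms i) (Fst D ms ns) = proj (ms @ ns) i"
  using assms unfolding farr_Fst[symmetric]
  by (subst proj_farr) (auto simp: Fst_MM Hom_MM_iff proj_def nth_append intro!: wf_eta_mvar)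

lemma proj_Snd:
  assumes "i < length ns"
  shows "Cmp D (ms @ ns) ns [ns ! i] (proj ns i) (Snd D ms ns) = proj (ms @ ns) (length ms + i)"
  using assms unfolding farr_Snd[symmetric]
  by (subst proj_farr) (auto simp: Snd_MM Hom_MM_iff proj_def nth_append intro!: wf_eta_mvar)

lemma proj_Cons_0: "proj (n # ns) 0 = Fst D [n] ns"
  using farr_Fst[of "[n]" ns] by (simp add: proj_def Fst_MM)

text \<open>By strictness \<open>n # ns\<close> is the binary product of \<open>[n]\<close> and
  \<open>ns\<close> on the nose. Its first projection is \<open>proj_Cons_0\<close>, and the others
  factor through \<open>Snd\<close> by \<open>proj_Snd\<close>. This justifies the definite
  description in \<open>tupling\<close>.\<close>

lemma tupling_ex1:
  assumes "length fs = length ns" "\<And>i. i < length ns \<Longrightarrow> fs ! i \<in> Hom D X [ns ! i]"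
  shows "\<exists>!p. p \<in> Hom D X ns \<and> (\<forall>i < length ns. Cmp D X ns [ns ! i] (proj ns i) p = fs ! i)"
  using assms
proof (induction ns arbitrary: fs)
  case Nil
  then show ?case using T.cod.One_terminal[of X] by simp
next
  case (Cons n ns)
  then obtain f fs' where fs: "fs = f # fs'" "length fs' = length ns"
    by (cases fs) auto
  have f: "f \<in> Hom D X [n]" "\<And>i. i < length ns \<Longrightarrow> fs' ! i \<in> Hom D X [ns ! i]"
    using Cons.prems(2)[of 0] Cons.prems(2)[of "Suc i" for i] fs by auto
  obtain p' where p': "p' \<in> Hom D X ns" "\<And>i. i < length ns \<Longrightarrow> Cmp D X ns [ns ! i] (proj ns i) p' = fs' ! i"
    and p'_uniq: "\<And>q. q \<in> Hom D X ns \<Longrightarrow>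
       (\<And>i. i < length ns \<Longrightarrow> Cmp D X ns [ns ! i] (proj ns i) q = fs' ! i) \<Longrightarrow> q = p'"
    using Cons.IH[OF fs(2) f(2)] by (metis (no_types, lifting))
  have step: "Cmp D X (n # ns) [(n # ns) ! Suc i] (proj (n # ns) (Suc i)) h =
      Cmp D X ns [ns ! i] (proj ns i) (Cmp D X (n # ns) ns (Snd D [n] ns) h)"
    if "h \<in> Hom D X (n # ns)" "i < length ns" for h i
    using proj_Snd[of i ns "[n]"] that Snd_in_Hom[of "[n]" ns]
    by (simp add: Cmp_assoc[OF _ _ proj_in_Hom])
  have "\<exists>!h. h \<in> Hom D X (n # ns) \<and> Cmp D X (n # ns) [n] (Fst D [n] ns) h = f \<and>
      Cmp D X (n # ns) ns (Snd D [n] ns) h = p'"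
    using T.cod.Prod_universal[of X "[n]" ns f p'] f p' by simp
  then obtain h where h: "h \<in> Hom D X (n # ns)" "Cmp D X (n # ns) [n] (Fst D [n] ns) h = f"
      "Cmp D X (n # ns) ns (Snd D [n] ns) h = p'"
    and h_uniq: "\<And>q. q \<in> Hom D X (n # ns) \<Longrightarrow> Cmp D X (n # ns) [n] (Fst D [n] ns) q = f \<Longrightarrow>
      Cmp D X (n # ns) ns (Snd D [n] ns) q = p' \<Longrightarrow> q = h"
    by (metis (no_types, lifting))
  show ?case
  proof (rule ex1I[of _ h], intro conjI allI impI)
    fix i assume "i < length (n # ns)"
    then show "Cmp D X (n # ns) [(n # ns) ! i] (proj (n # ns) i) h = fs ! i"
      using step[OF h(1)] h p' fs by (cases i) (auto simp: proj_Cons_0)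
  next
    fix q
    assume q: "q \<in> Hom D X (n # ns) \<and>
      (\<forall>i<length (n # ns). Cmp D X (n # ns) [(n # ns) ! i] (proj (n # ns) i) q = fs ! i)"
    have "Cmp D X (n # ns) ns (Snd D [n] ns) q = p'"
    proof (rule p'_uniq)
      show "Cmp D X (n # ns) ns (Snd D [n] ns) q \<in> Hom D X ns"
        using q Snd_in_Hom[of "[n]" ns] Cmp_in_Hom by simp
      show "Cmp D X ns [ns ! i] (proj ns i) (Cmp D X (n # ns) ns (Snd D [n] ns) q) = fs' ! i"
        if "i < length ns" for i
        using q that step[of q i] fs by (metis Suc_less_eq length_Cons nth_Cons_Suc)
    qed
    then show "q = h" using q fs h_uniq[of q] by (force simp: proj_Cons_0)
  qed (rule h)
qed

abbreviation "tup \<equiv> tupling D T"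

definition homs :: "nat list \<Rightarrow> nat list \<Rightarrow> 'a list \<Rightarrow> bool" where
  "homs X ns fs \<longleftrightarrow> length fs = length ns \<and> (\<forall>i < length ns. fs ! i \<in> Hom D X [ns ! i])"

lemma homs_simps [simp]:
  "homs X [] fs \<longleftrightarrow> fs = []"
  "homs X (n # ns) (f # fs) \<longleftrightarrow> f \<in> Hom D X [n] \<and> homs X ns fs"
  "homs X (n # ns) [] \<longleftrightarrow> False"
  by (auto simp: homs_def nth_Cons' less_Suc_eq_0_disj)

lemma homs_append [simp]:
  "length fs = length ms \<Longrightarrow> homs X (ms @ ns) (fs @ gs) \<longleftrightarrow> homs X ms fs \<and> homs X ns gs"
  by (induction fs ms rule: list_induct2) auto

lemma homs_replicate: "homs X (replicate k n) fs \<longleftrightarrow> length fs = k \<and> (\<forall>f \<in> set fs. f \<in> Hom D X [n])"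
  by (auto simp: homs_def all_set_conv_all_nth)

lemma homs_map_upt:
  "homs X ns (map f [0..<length ns]) \<longleftrightarrow> (\<forall>i < length ns. f i \<in> Hom D X [ns ! i])"
  by (simp add: homs_def)

lemma
  assumes "homs X ns fs"
  shows tup_in_Hom: "tup X ns fs \<in> Hom D X ns"
    and proj_tup: "i < length ns \<Longrightarrow> Cmp D X ns [ns ! i] (proj ns i) (tup X ns fs) = fs ! i"
proof -
  have "\<exists>!p. p \<in> Hom D X ns \<and> (\<forall>i < length ns. Cmp D X ns [ns ! i] (proj ns i) p = fs ! i)"
    using assms by (intro tupling_ex1) (auto simp: homs_def)
  from theI'[OF this] show "tup X ns fs \<in> Hom D X ns"
    "i < length ns \<Longrightarrow> Cmp D X ns [ns ! i] (proj ns i) (tup X ns fs) = fs ! i"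
    by (simp_all add: tupling_def proj_def)
qed

lemma tup_eqI:
  assumes "p \<in> Hom D X ns" "q \<in> Hom D X ns"
    and "\<And>i. i < length ns \<Longrightarrow>
      Cmp D X ns [ns ! i] (proj ns i) p = Cmp D X ns [ns ! i] (proj ns i) q"
  shows "p = q"
  using tupling_ex1[of "map (\<lambda>i. Cmp D X ns [ns ! i] (proj ns i) p) [0..<length ns]" ns X]
    assms Cmp_in_Hom[OF assms(1) proj_in_Hom]
  by (auto simp: ex1_iff_ex_Uniq Uniq_def)

lemma tup_Cmp:
  assumes "homs X ns fs" "\<sigma> \<in> Hom D Y X"
  shows "Cmp D Y X ns (tup X ns fs) \<sigma> =
    tup Y ns (map (\<lambda>i. Cmp D Y X [ns ! i] (fs ! i) \<sigma>) [0..<length ns])"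
proof -
  have *: "homs Y ns (map (\<lambda>i. Cmp D Y X [ns ! i] (fs ! i) \<sigma>) [0..<length ns])"
    using assms by (auto simp: homs_def intro: Cmp_in_Hom)
  show ?thesis
    by (rule tup_eqI)
      (use assms * in \<open>auto simp: proj_tup Cmp_assoc[OF _ tup_in_Hom proj_in_Hom]
        intro: Cmp_in_Hom tup_in_Hom\<close>)
qed

lemma tup_proj:
  assumes "p \<in> Hom D X ns"
  shows "tup X ns (map (\<lambda>i. Cmp D X ns [ns ! i] (proj ns i) p) [0..<length ns]) = p"
proof -
  have *: "homs X ns (map (\<lambda>i. Cmp D X ns [ns ! i] (proj ns i) p) [0..<length ns])"
    using Cmp_in_Hom[OF assms proj_in_Hom] by (simp add: homs_def)
  show ?thesis by (rule tup_eqI) (use assms * in \<open>auto simp: proj_tup tup_in_Hom\<close>)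
qed

text \<open>\<open>act X \<Psi> n s fs\<close> is the value of a term \<open>s\<close> over the empty signature when the metavariables
  of \<open>\<Psi>\<close> take the values \<open>fs\<close> at stage \<open>X\<close>.\<close>

definition act :: "nat list \<Rightarrow> nat list \<Rightarrow> nat \<Rightarrow> unit tm \<Rightarrow> 'a list \<Rightarrow> 'a" where
  "act X \<Psi> n s fs = Cmp D X \<Psi> [n] (farr T \<Psi> [n] [s]) (tup X \<Psi> fs)"

lemma act_in_Hom:
  assumes "wf_tm empty_sig \<Psi> n s" "homs X \<Psi> fs"
  shows "act X \<Psi> n s fs \<in> Hom D X [n]"
  unfolding act_def using assms by (intro Cmp_in_Hom farr_in_Hom tup_in_Hom) auto

lemma act_eta_mvar:
  assumes "homs X \<Psi> fs" "i < length \<Psi>" "n = \<Psi> ! i"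
  shows "act X \<Psi> n (eta_mvar i n) fs = fs ! i"
  using proj_tup[OF assms(1,2)] assms(3) by (simp add: act_def proj_def)

lemma act_mvar_0:
  assumes "homs X \<Psi> fs" "i < length \<Psi>" "\<Psi> ! i = 0"
  shows "act X \<Psi> 0 (MVar i []) fs = fs ! i"
  using act_eta_mvar[of X \<Psi> fs i 0] assms by (simp add: eta_mvar_def)

text \<open>Functoriality of \<open>T\<close>, read as a substitution lemma: the tuple of the values
  of the \<open>ss\<close> is \<open>farr T \<Psi>' \<Psi> ss\<close> composed with the tuple of
  \<open>fs\<close>. Equations between evaluations at different arities are derived from it.\<close>

lemma act_msub:
  assumes "wf_tm empty_sig \<Psi> n s" "length ss = length \<Psi>"
    and "\<And>i. i < length \<Psi> \<Longrightarrow> wf_tm empty_sig \<Psi>' (\<Psi> ! i) (ss ! i)" "homs X \<Psi>' fs"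
  shows "act X \<Psi>' n (msub (zip \<Psi> ss) s) fs =
    act X \<Psi> n s (map (\<lambda>i. act X \<Psi>' (\<Psi> ! i) (ss ! i) fs) [0..<length \<Psi>])"
proof -
  have ss: "ss \<in> Hom MM \<Psi>' \<Psi>" using assms by (simp add: Hom_MM_iff)
  have fT: "farr T \<Psi>' \<Psi> ss \<in> Hom D \<Psi>' \<Psi>" using ss by (rule farr_in_Hom)
  have "act X \<Psi>' n (msub (zip \<Psi> ss) s) fs =
    Cmp D X \<Psi> [n] (farr T \<Psi> [n] [s]) (Cmp D X \<Psi>' \<Psi> (farr T \<Psi>' \<Psi> ss) (tup X \<Psi>' fs))"
    using farr_Cmp[of ss \<Psi>' \<Psi> "[s]" "[n]"] assms ss fT
    by (simp add: act_def Cmp_assoc[OF tup_in_Hom _ farr_in_Hom])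
  also have "Cmp D X \<Psi>' \<Psi> (farr T \<Psi>' \<Psi> ss) (tup X \<Psi>' fs) =
    tup X \<Psi> (map (\<lambda>i. Cmp D X \<Psi> [\<Psi> ! i] (proj \<Psi> i)
      (Cmp D X \<Psi>' \<Psi> (farr T \<Psi>' \<Psi> ss) (tup X \<Psi>' fs))) [0..<length \<Psi>])"
    using assms fT by (intro tup_proj[symmetric] Cmp_in_Hom tup_in_Hom)
  also have "map (\<lambda>i. Cmp D X \<Psi> [\<Psi> ! i] (proj \<Psi> i)
      (Cmp D X \<Psi>' \<Psi> (farr T \<Psi>' \<Psi> ss) (tup X \<Psi>' fs))) [0..<length \<Psi>] =
    map (\<lambda>i. act X \<Psi>' (\<Psi> ! i) (ss ! i) fs) [0..<length \<Psi>]"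
    using assms fT ss
    by (auto simp: act_def proj_farr Cmp_assoc[OF tup_in_Hom[OF assms(4)] fT proj_in_Hom])
  finally show ?thesis by (simp add: act_def)
qed

lemma act_Cmp:
  assumes "wf_tm empty_sig \<Psi> n s" "homs X \<Psi> fs" "\<sigma> \<in> Hom D Y X"
  shows "Cmp D Y X [n] (act X \<Psi> n s fs) \<sigma> =
    act Y \<Psi> n s (map (\<lambda>i. Cmp D Y X [\<Psi> ! i] (fs ! i) \<sigma>) [0..<length \<Psi>])"
  using assms by (simp add: act_def tup_Cmp[symmetric] Cmp_assoc[OF _ tup_in_Hom farr_in_Hom])

text \<open>A term without variables: the function and its arguments are all metavariables. Its
  image under \<open>T\<close> is the evaluation map from \<open>[n]\<close> times n copies of
  \<open>[0]\<close> to \<open>[0]\<close>.\<close>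

definition app_tm :: "nat \<Rightarrow> unit tm" where
  "app_tm n = MVar 0 (map (\<lambda>j. MVar (Suc j) []) [0..<n])"

lemma wf_app_tm: "wf_tm empty_sig (n # replicate n 0) k (app_tm n)"
  by (auto simp: app_tm_def intro!: wf_tm.intros)

definition app :: "nat list \<Rightarrow> nat \<Rightarrow> 'a \<Rightarrow> 'a list \<Rightarrow> 'a" where
  "app X n g as = act X (n # replicate n 0) 0 (app_tm n) (g # as)"

lemma app_in_Hom:
  assumes "g \<in> Hom D X [n]" "homs X (replicate n 0) as"
  shows "app X n g as \<in> Hom D X [0]"
  unfolding app_def using assms by (intro act_in_Hom wf_app_tm) simp

lemma app_Cmp:
  assumes "g \<in> Hom D X [n]" "homs X (replicate n 0) as" "\<sigma> \<in> Hom D Y X"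
  shows "Cmp D Y X [0] (app X n g as) \<sigma> =
    app Y n (Cmp D Y X [n] g \<sigma>) (map (\<lambda>a. Cmp D Y X [0] a \<sigma>) as)"
proof -
  have l: "length as = n" using assms(2) by (simp add: homs_def)
  have "map (\<lambda>i. Cmp D Y X [replicate n 0 ! i] (as ! i) \<sigma>) [0..<n] = map (\<lambda>a. Cmp D Y X [0] a \<sigma>) as"
    using l by (intro nth_equalityI) simp_all
  then have "map (\<lambda>i. Cmp D Y X [(n # replicate n 0) ! i] ((g # as) ! i) \<sigma>) [0..<length (n # replicate n 0)] =
    Cmp D Y X [n] g \<sigma> # map (\<lambda>a. Cmp D Y X [0] a \<sigma>) as"
    by (simp add: map_upt_Cons del: upt_Suc)
  then show ?thesis
    using act_Cmp[OF wf_app_tm[of n 0], of X "g # as" \<sigma> Y] assms by (simp add: app_def del: upt_Suc)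
qed

text \<open>\<open>inst (m, s) us\<close> is \<open>app_tm m\<close> with \<open>s\<close> and
  \<open>us\<close> put for its metavariables, so this is an instance of
  \<open>act_msub\<close>.\<close>

lemma act_inst:
  assumes "wf_tm empty_sig \<Psi> m s" "length us = m"
    and "\<And>u. u \<in> set us \<Longrightarrow> wf_tm empty_sig \<Psi> 0 u" "homs X \<Psi> fs"
  shows "act X \<Psi> 0 (inst (m, s) us) fs =
    app X m (act X \<Psi> m s fs) (map (\<lambda>u. act X \<Psi> 0 u fs) us)"
proof -
  have "map (msub (zip (m # replicate m 0) (s # us))) (map (\<lambda>j. MVar (Suc j) []) [0..<m]) = us"
    using assms(2) by (intro nth_equalityI) (simp_all add: inst_def)
  then have "msub (zip (m # replicate m 0) (s # us)) (app_tm m) = inst (m, s) us"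
    by (simp add: app_tm_def)
  moreover have "map (\<lambda>i. act X \<Psi> (replicate m 0 ! i) (us ! i) fs) [0..<m] =
    map (\<lambda>u. act X \<Psi> 0 u fs) us"
    using assms(2) by (intro nth_equalityI) simp_all
  then have "map (\<lambda>i. act X \<Psi> ((m # replicate m 0) ! i) ((s # us) ! i) fs) [0..<length (m # replicate m 0)] =
    act X \<Psi> m s fs # map (\<lambda>u. act X \<Psi> 0 u fs) us"
    by (simp add: map_upt_Cons del: upt_Suc)
  moreover have "wf_tm empty_sig \<Psi> ((m # replicate m 0) ! i) ((s # us) ! i)" if "i < Suc m" for i
    using that assms by (cases i) auto
  ultimately show ?thesis
    using act_msub[OF wf_app_tm[of m 0], of "s # us" \<Psi> X fs] assms(2,4)
    by (simp add: app_def)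
qed

section \<open>Abstraction of several variables\<close>

definition wkn :: "nat list \<Rightarrow> nat \<Rightarrow> 'a" where
  "wkn X k = Fst D X (replicate k 0)"

text \<open>The variables are counted from the right, so that the variable of index \<open>k\<close> in an extension of
  \<open>X\<close> by \<open>Suc k\<close> variables is the one by which \<open>X\<close> is extended first. It is the last argument of an
  element of \<open>[Suc k]\<close>, hence the one split off by the exponential \<open>[Suc k]\<close> of \<open>[k]\<close>.\<close>

definition var :: "nat list \<Rightarrow> nat \<Rightarrow> nat \<Rightarrow> 'a" where
  "var X k j = proj (X @ replicate k 0) (length X + (k - Suc j))"

lemma wkn_in_Hom: "wkn X k \<in> Hom D (X @ replicate k 0) X"
  unfolding wkn_def by (rule Fst_in_Hom)

lemma var_in_Hom: "j < k \<Longrightarrow> var X k j \<in> Hom D (X @ replicate k 0) [0]"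
  unfolding var_def by (rule proj_in_Hom) (auto simp: nth_append)

lemma homs_vars: "homs (X @ replicate k 0) (replicate k 0) (map (var X k) [0..<k])"
  by (auto simp: homs_replicate intro: var_in_Hom)

lemma proj_wkn:
  "i < length X \<Longrightarrow> n = X ! i \<Longrightarrow>
    Cmp D (X @ replicate k 0) X [n] (proj X i) (wkn X k) = proj (X @ replicate k 0) i"
  unfolding wkn_def by (simp add: proj_Fst)

text \<open>The arrow into the extended stage with components \<open>\<sigma>\<close> and the
  \<open>a j\<close>. The reversal matches the order in which \<open>var\<close> reads off the added
  factors.\<close>

definition push :: "nat list \<Rightarrow> nat list \<Rightarrow> nat \<Rightarrow> 'a \<Rightarrow> (nat \<Rightarrow> 'a) \<Rightarrow> 'a" where
  "push Y X k \<sigma> a = tup Y (X @ replicate k 0)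
     (map (\<lambda>i. Cmp D Y X [X ! i] (proj X i) \<sigma>) [0..<length X] @ rev (map a [0..<k]))"

lemma
  assumes "\<sigma> \<in> Hom D Y X" "\<And>j. j < k \<Longrightarrow> a j \<in> Hom D Y [0]"
  shows push_in_Hom: "push Y X k \<sigma> a \<in> Hom D Y (X @ replicate k 0)"
    and wkn_push: "Cmp D Y (X @ replicate k 0) X (wkn X k) (push Y X k \<sigma> a) = \<sigma>"
    and var_push: "j < k \<Longrightarrow> Cmp D Y (X @ replicate k 0) [0] (var X k j) (push Y X k \<sigma> a) = a j"
proof -
  let ?X = "X @ replicate k 0"
  let ?fs = "map (\<lambda>i. Cmp D Y X [X ! i] (proj X i) \<sigma>) [0..<length X] @ rev (map a [0..<k])"
  have h: "homs Y ?X ?fs"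
    using assms Cmp_in_Hom[OF assms(1) proj_in_Hom]
    by (simp add: homs_replicate homs_map_upt)
  show p: "push Y X k \<sigma> a \<in> Hom D Y ?X"
    unfolding push_def by (rule tup_in_Hom[OF h])
  show "Cmp D Y ?X X (wkn X k) (push Y X k \<sigma> a) = \<sigma>"
  proof (rule tup_eqI[OF Cmp_in_Hom[OF p wkn_in_Hom] assms(1)])
    fix i assume i: "i < length X"
    then show "Cmp D Y X [X ! i] (proj X i) (Cmp D Y ?X X (wkn X k) (push Y X k \<sigma> a)) =
      Cmp D Y X [X ! i] (proj X i) \<sigma>"
      using proj_tup[OF h, of i]
      by (simp add: Cmp_assoc[OF p wkn_in_Hom proj_in_Hom] proj_wkn)
        (simp add: push_def nth_append)
  qed
  assume j: "j < k"
  then have "?X ! (length X + (k - Suc j)) = 0" "length X + (k - Suc j) < length ?X"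
    "?fs ! (length X + (k - Suc j)) = a j"
    by (auto simp: nth_append rev_nth)
  then show "Cmp D Y ?X [0] (var X k j) (push Y X k \<sigma> a) = a j"
    using proj_tup[OF h, of "length X + (k - Suc j)"] by (simp only: push_def var_def)
qed

text \<open>The product of \<open>\<sigma>\<close> with the identity on the added variables: change
  of stage under a binder.\<close>

definition lift_arr :: "nat list \<Rightarrow> nat list \<Rightarrow> nat \<Rightarrow> 'a \<Rightarrow> 'a" where
  "lift_arr Y X k \<sigma> =
     push (Y @ replicate k 0) X k (Cmp D (Y @ replicate k 0) Y X \<sigma> (wkn Y k)) (var Y k)"

lemma
  assumes "\<sigma> \<in> Hom D Y X"
  shows lift_arr_in_Hom: "lift_arr Y X k \<sigma> \<in> Hom D (Y @ replicate k 0) (X @ replicate k 0)"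
    and wkn_lift_arr: "Cmp D (Y @ replicate k 0) (X @ replicate k 0) X (wkn X k) (lift_arr Y X k \<sigma>) =
      Cmp D (Y @ replicate k 0) Y X \<sigma> (wkn Y k)"
    and var_lift_arr: "j < k \<Longrightarrow>
      Cmp D (Y @ replicate k 0) (X @ replicate k 0) [0] (var X k j) (lift_arr Y X k \<sigma>) = var Y k j"
  unfolding lift_arr_def
  by (simp_all add: push_in_Hom wkn_push var_push Cmp_in_Hom[OF wkn_in_Hom assms] var_in_Hom)

section \<open>Exponentials, and evaluation at one argument after another\<close>

lemma proj_singleton: "proj [n] 0 = Id D [n]"
  using farr_Id[of "[n]"] by (simp add: proj_def Id_MM)

lemma Snd_singletons: "Snd D [m] [n] = proj [m, n] (Suc 0)"
  using proj_Snd[of 0 "[n]" "[m]"] Cmp_Id_left[OF Snd_in_Hom[of "[m]" "[n]"]]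
  by (simp add: proj_singleton)

lemma pairing_eq_tup:
  assumes "f \<in> Hom D X [m]" "g \<in> Hom D X [n]"
  shows "pairing D X [m] [n] f g = tup X [m, n] [f, g]"
  unfolding pairing_def
proof (rule the1_equality)
  show "\<exists>!h. h \<in> Hom D X (Prod D [m] [n]) \<and> Cmp D X (Prod D [m] [n]) [m] (Fst D [m] [n]) h = f \<and>
      Cmp D X (Prod D [m] [n]) [n] (Snd D [m] [n]) h = g"
    using T.cod.Prod_universal[of X "[m]" "[n]" f g] assms by simp
  have h: "homs X [m, n] [f, g]" using assms by simp
  show "tup X [m, n] [f, g] \<in> Hom D X (Prod D [m] [n]) \<and>
    Cmp D X (Prod D [m] [n]) [m] (Fst D [m] [n]) (tup X [m, n] [f, g]) = f \<and>
    Cmp D X (Prod D [m] [n]) [n] (Snd D [m] [n]) (tup X [m, n] [f, g]) = g"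
    using proj_tup[OF h, of 0] proj_tup[OF h, of 1] tup_in_Hom[OF h]
    by (simp add: proj_Cons_0 Snd_singletons)
qed

definition ev_tm :: "nat \<Rightarrow> unit tm" where
  "ev_tm k = MVar 0 (map Var [0..<k] @ [MVar 1 []])"

lemma wf_ev_tm: "wf_tm empty_sig [Suc k, 0] k (ev_tm k)"
  by (auto simp: ev_tm_def intro!: wf_tm.intros)

text \<open>The assumed exponential at the object \<open>[k]\<close>, where \<open>MM_exp\<close>
  gives \<open>[Suc k]\<close> and \<open>MM_ev\<close> gives \<open>[ev_tm k]\<close>. The pairing
  is rewritten as a tuple so that the lemmas on \<open>act\<close> apply.\<close>

lemma exponential_ex1:
  assumes "f \<in> Hom D (X @ [0]) [k]"
  shows "\<exists>!g. g \<in> Hom D X [Suc k] \<and>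
    act (X @ [0]) [Suc k, 0] k (ev_tm k) [Cmp D (X @ [0]) X [Suc k] g (wkn X 1), Snd D X [0]] = f"
proof -
  have "is_exponential D [0] [k] [Suc k] (farr T [Suc k, 0] [k] [ev_tm k])"
    using soat unfolding soat_def preserves_MM_exponentials_def
    by (auto simp: MM_exp_def MM_ev_def ev_tm_def dest!: conjunct2 spec[of _ "[k]"])
  then have *: "\<exists>!g. g \<in> Hom D X [Suc k] \<and>
      Cmp D (X @ [0]) [Suc k, 0] [k] (farr T [Suc k, 0] [k] [ev_tm k])
        (pairing D (X @ [0]) [Suc k] [0]
          (Cmp D (X @ [0]) X [Suc k] g (Fst D X [0])) (Snd D X [0])) = f"
    using assms by (simp add: is_exponential_def)
  have "g \<in> Hom D X [Suc k] \<and>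
      Cmp D (X @ [0]) [Suc k, 0] [k] (farr T [Suc k, 0] [k] [ev_tm k])
        (pairing D (X @ [0]) [Suc k] [0]
          (Cmp D (X @ [0]) X [Suc k] g (Fst D X [0])) (Snd D X [0])) = f \<longleftrightarrow>
    g \<in> Hom D X [Suc k] \<and>
    act (X @ [0]) [Suc k, 0] k (ev_tm k) [Cmp D (X @ [0]) X [Suc k] g (wkn X 1), Snd D X [0]] = f" for g
    using Cmp_in_Hom[OF Fst_in_Hom[of X "[0]"], of g "[Suc k]"] Snd_in_Hom[of X "[0]"]
    by (auto simp: act_def wkn_def pairing_eq_tup)
  with * show ?thesis by simp
qed

lemma app_0:
  assumes "g \<in> Hom D X [0]"
  shows "app X 0 g [] = g"
  using act_eta_mvar[of X "[0]" "[g]" 0 0] assms by (simp add: app_def app_tm_def eta_mvar_def)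

text \<open>In the context \<open>\<Psi>\<close> of the function and all arguments,
  \<open>app_tm (Suc k)\<close> is \<open>s\<close> with \<open>us\<close> substituted for its
  variables, and \<open>s\<close> is a metasubstitution instance of \<open>ev_tm k\<close>. Hence
  \<open>act_inst\<close> and \<open>act_msub\<close> split off the last argument, the one the
  exponential evaluates.\<close>

lemma app_Suc:
  assumes "g \<in> Hom D X [Suc k]" "homs X (replicate k 0) as" "a \<in> Hom D X [0]"
  shows "app X (Suc k) g (as @ [a]) = app X k (act X [Suc k, 0] k (ev_tm k) [g, a]) as"
proof -
  define \<Psi> where "\<Psi> = Suc k # replicate (Suc k) 0"
  define fs where "fs = g # as @ [a]"
  define s :: "unit tm" where "s = MVar 0 (map Var [0..<k] @ [MVar (Suc k) []])"
  define us :: "unit tm list" where "us = map (\<lambda>j. MVar (Suc j) []) [0..<k]"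
  have l: "length as = k" using assms by (simp add: homs_def)
  have fs: "homs X \<Psi> fs"
    using assms l by (simp add: \<Psi>_def fs_def homs_replicate del: replicate_Suc)
  have \<Psi>: "length \<Psi> = Suc (Suc k)" "\<And>j. j < Suc k \<Longrightarrow> \<Psi> ! Suc j = 0" "\<Psi> ! 0 = Suc k"
    by (simp_all add: \<Psi>_def del: replicate_Suc)
  have s: "wf_tm empty_sig \<Psi> k s"
    using \<Psi> by (auto simp: s_def intro!: wf_tm.intros)
  have us: "u \<in> set us \<Longrightarrow> wf_tm empty_sig \<Psi> 0 u" for u
    using \<Psi> by (auto simp: us_def intro!: wf_tm.intros)
  have "map (sub (\<lambda>j. if j < k then us ! j else Var (j - k))) (map Var [0..<k]) = us"
    by (intro nth_equalityI) (simp_all add: us_def)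
  then have "inst (k, s) us = app_tm (Suc k)"
    by (simp add: inst_def s_def app_tm_def us_def comp_def)
  then have "app X (Suc k) g (as @ [a]) = act X \<Psi> 0 (inst (k, s) us) fs"
    by (simp add: app_def \<Psi>_def fs_def)
  also have "\<dots> = app X k (act X \<Psi> k s fs) (map (\<lambda>u. act X \<Psi> 0 u fs) us)"
    by (rule act_inst[OF s _ us fs]) (simp_all add: us_def)
  also have "map (\<lambda>u. act X \<Psi> 0 u fs) us = as"
    using l \<Psi> by (intro nth_equalityI) (simp_all add: us_def act_mvar_0[OF fs], simp add: fs_def nth_append)
  also have "act X \<Psi> k s fs = act X [Suc k, 0] k (ev_tm k) [g, a]"
  proof -
    have w: "wf_tm empty_sig \<Psi> ([Suc k, 0] ! i) ([eta_mvar 0 (Suc k), MVar (Suc k) []] ! i)" if "i < 2" for i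
      using that \<Psi> by (auto simp: less_2_cases_iff intro!: wf_eta_mvar wf_tm.intros)
    let ?\<tau> = "zip [Suc k, 0] [eta_mvar 0 (Suc k), MVar (Suc k) [] :: unit tm]"
    have "inst (Suc k, eta_mvar 0 (Suc k)) (map Var [0..<k] @ [MVar (Suc k) []]) = s"
      by (subst inst_eta_mvar) (simp_all add: s_def del: upt_Suc)
    moreover have "map (msub ?\<tau>) (map Var [0..<k] @ [MVar 1 []]) = map Var [0..<k] @ [MVar (Suc k) []]"
      by (simp add: comp_def inst_def)
    ultimately have "msub ?\<tau> (ev_tm k) = s"
      unfolding ev_tm_def msub.simps by (simp del: map_append)
    moreover have "act X \<Psi> (Suc k) (eta_mvar 0 (Suc k)) fs = g" "act X \<Psi> 0 (MVar (Suc k) []) fs = a"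
      using \<Psi> act_eta_mvar[OF fs, of 0 "Suc k"] act_mvar_0[OF fs, of "Suc k"]
      by (simp_all add: fs_def flip: l)
    ultimately show ?thesis
      using act_msub[OF wf_ev_tm[of k], of "[eta_mvar 0 (Suc k), MVar (Suc k) []]" \<Psi> X fs] w fs
      by (simp add: numeral_2_eq_2)
  qed
  finally show ?thesis .
qed

lemma var_Suc: "j < k \<Longrightarrow> var X (Suc k) j = var (X @ [0]) k j"
  by (simp add: var_def Suc_diff_Suc) 

lemma var_last: "var X (Suc k) k = Cmp D (X @ replicate (Suc k) 0) (X @ [0]) [0] (Snd D X [0]) (wkn (X @ [0]) k)"
proof -
  have "Snd D X [0] = proj (X @ [0]) (length X)"
    using proj_Snd[of 0 "[0]" X] Cmp_Id_left[OF Snd_in_Hom[of X "[0]"]]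
    by (simp add: proj_singleton)
  then show ?thesis using proj_wkn[of "length X" "X @ [0]" 0 k] by (simp add: var_def)
qed

lemma wkn_Suc: "wkn X (Suc k) = Cmp D (X @ replicate (Suc k) 0) (X @ [0]) X (wkn X 1) (wkn (X @ [0]) k)"
proof (rule tup_eqI)
  show "Cmp D (X @ replicate (Suc k) 0) (X @ [0]) X (wkn X 1) (wkn (X @ [0]) k) \<in> Hom D (X @ replicate (Suc k) 0) X"
    using wkn_in_Hom[of X 1] wkn_in_Hom[of "X @ [0]" k] by (auto intro: Cmp_in_Hom)
  fix i assume i: "i < length X"
  then show "Cmp D (X @ replicate (Suc k) 0) X [X ! i] (proj X i) (wkn X (Suc k)) =
    Cmp D (X @ replicate (Suc k) 0) X [X ! i] (proj X i)
     (Cmp D (X @ replicate (Suc k) 0) (X @ [0]) X (wkn X 1) (wkn (X @ [0]) k))"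
    using Cmp_assoc[OF _ _ proj_in_Hom[OF i HOL.refl], of "wkn (X @ [0]) k" "X @ replicate (Suc k) 0" "X @ [0]" "wkn X 1"]
      wkn_in_Hom[of X 1] wkn_in_Hom[of "X @ [0]" k] proj_wkn[of i X "X ! i" 1] proj_wkn[of i "X @ [0]" "X ! i" k]
      proj_wkn[of i X "X ! i" "Suc k"]
    by (simp add: nth_append)
qed (rule wkn_in_Hom)

lemma wkn_0 [simp]: "wkn X 0 = Id D X"
  using farr_Fst[of X "[]"] farr_Id[of X] by (simp add: wkn_def Fst_MM Id_MM)

text \<open>For \<open>Suc k\<close>, the map from \<open>g\<close> to its value at the generic
  variables is \<open>?ev\<close> followed by \<open>?app\<close>; this is \<open>eq\<close>. The
  first is bijective by the exponential at stage \<open>X\<close>, the second by the induction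
  hypothesis at stage \<open>X @ [0]\<close>.\<close>

lemma abstraction_ex1:
  assumes "h \<in> Hom D (X @ replicate k 0) [0]"
  shows "\<exists>!g. g \<in> Hom D X [k] \<and>
    app (X @ replicate k 0) k (Cmp D (X @ replicate k 0) X [k] g (wkn X k)) (map (var X k) [0..<k]) = h"
  using assms
proof (induction k arbitrary: X)
  case 0
  then have "\<And>g. g \<in> Hom D X [0] \<and> app X 0 (Cmp D X X [0] g (Id D X)) [] = h \<longleftrightarrow> g = h"
    by (auto simp: app_0 Cmp_Id_right)
  then show ?case by simp
next
  case (Suc k)
  let ?X = "X @ replicate (Suc k) 0"
  let ?ev = "\<lambda>g. act (X @ [0]) [Suc k, 0] k (ev_tm k) [Cmp D (X @ [0]) X [Suc k] g (wkn X 1), Snd D X [0]]"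
  let ?app = "\<lambda>g. app ?X k (Cmp D ?X (X @ [0]) [k] g (wkn (X @ [0]) k)) (map (var (X @ [0]) k) [0..<k])"
  have S: "Snd D X [0] \<in> Hom D (X @ [0]) [0]" by (rule Snd_in_Hom)
  have w: "wkn (X @ [0]) k \<in> Hom D ?X (X @ [0])" "wkn X 1 \<in> Hom D (X @ [0]) X"
    using wkn_in_Hom[of "X @ [0]" k] wkn_in_Hom[of X 1] by simp_all
  have eq: "app ?X (Suc k) (Cmp D ?X X [Suc k] g (wkn X (Suc k))) (map (var X (Suc k)) [0..<Suc k]) = ?app (?ev g)"
    if g: "g \<in> Hom D X [Suc k]" for g
  proof -
    have vs: "map (var X (Suc k)) [0..<Suc k] = map (var (X @ [0]) k) [0..<k] @
        [Cmp D ?X (X @ [0]) [0] (Snd D X [0]) (wkn (X @ [0]) k)]"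
      by (simp add: var_Suc var_last)
    have gw: "Cmp D (X @ [0]) X [Suc k] g (wkn X 1) \<in> Hom D (X @ [0]) [Suc k]"
      using g w(2) by (rule Cmp_in_Hom[rotated])
    have "Cmp D ?X X [Suc k] g (wkn X (Suc k)) =
        Cmp D ?X (X @ [0]) [Suc k] (Cmp D (X @ [0]) X [Suc k] g (wkn X 1)) (wkn (X @ [0]) k)"
      unfolding wkn_Suc using g w by (simp only: Cmp_assoc)
    moreover have "Cmp D ?X (X @ [0]) [k] (?ev g) (wkn (X @ [0]) k) =
      act ?X [Suc k, 0] k (ev_tm k)
        [Cmp D ?X (X @ [0]) [Suc k] (Cmp D (X @ [0]) X [Suc k] g (wkn X 1)) (wkn (X @ [0]) k),
         Cmp D ?X (X @ [0]) [0] (Snd D X [0]) (wkn (X @ [0]) k)]"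
      using act_Cmp[OF wf_ev_tm _ w(1), of k "[Cmp D (X @ [0]) X [Suc k] g (wkn X 1), Snd D X [0]]"] gw S by simp
    ultimately show ?thesis
      unfolding vs using app_Suc[of _ ?X k "map (var (X @ [0]) k) [0..<k]"] homs_vars[of "X @ [0]" k]
        Cmp_in_Hom[OF w(1) gw] Cmp_in_Hom[OF w(1) S] by simp
  qed
  have ev: "?ev g \<in> Hom D (X @ [0]) [k]" if "g \<in> Hom D X [Suc k]" for g
    using that w S by (auto intro!: act_in_Hom wf_ev_tm Cmp_in_Hom[of _ _ X])
  obtain f where f: "f \<in> Hom D (X @ [0]) [k]" "?app f = h"
    and f_uniq: "\<And>f'. f' \<in> Hom D (X @ [0]) [k] \<Longrightarrow> ?app f' = h \<Longrightarrow> f' = f"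
    using Suc.IH[of "X @ [0]"] Suc.prems by auto
  obtain g where g: "g \<in> Hom D X [Suc k]" "?ev g = f"
    and g_uniq: "\<And>g'. g' \<in> Hom D X [Suc k] \<Longrightarrow> ?ev g' = f \<Longrightarrow> g' = g"
    using exponential_ex1[OF f(1)] by (metis (no_types, lifting))
  show ?case
  proof (rule ex1I[of _ g])
    show "g \<in> Hom D X [Suc k] \<and>
      app ?X (Suc k) (Cmp D ?X X [Suc k] g (wkn X (Suc k))) (map (var X (Suc k)) [0..<Suc k]) = h"
      using g f eq[OF g(1)] by simp
    fix g' assume "g' \<in> Hom D X [Suc k] \<and>
      app ?X (Suc k) (Cmp D ?X X [Suc k] g' (wkn X (Suc k))) (map (var X (Suc k)) [0..<Suc k]) = h"
    then show "g' = g" using eq ev f_uniq g_uniq by metis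
  qed
qed

definition lam :: "nat list \<Rightarrow> nat \<Rightarrow> 'a \<Rightarrow> 'a" where
  "lam X k h = (THE g. g \<in> Hom D X [k] \<and>
     app (X @ replicate k 0) k (Cmp D (X @ replicate k 0) X [k] g (wkn X k)) (map (var X k) [0..<k]) = h)"

lemma
  assumes "h \<in> Hom D (X @ replicate k 0) [0]"
  shows lam_in_Hom: "lam X k h \<in> Hom D X [k]"
    and app_lam_vars: "app (X @ replicate k 0) k
      (Cmp D (X @ replicate k 0) X [k] (lam X k h) (wkn X k)) (map (var X k) [0..<k]) = h"
  using theI'[OF abstraction_ex1[OF assms]] by (simp_all add: lam_def)

lemma app_vars_in_Hom:
  assumes "g \<in> Hom D X [k]"
  shows "app (X @ replicate k 0) k (Cmp D (X @ replicate k 0) X [k] g (wkn X k)) (map (var X k) [0..<k])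
    \<in> Hom D (X @ replicate k 0) [0]"
  by (intro app_in_Hom homs_vars Cmp_in_Hom[OF wkn_in_Hom] assms)

lemma lam_app_vars:
  assumes "g \<in> Hom D X [k]"
  shows "lam X k (app (X @ replicate k 0) k
    (Cmp D (X @ replicate k 0) X [k] g (wkn X k)) (map (var X k) [0..<k])) = g"
  unfolding lam_def using abstraction_ex1[OF app_vars_in_Hom[OF assms]] assms
  by (intro the1_equality) auto

text \<open>\<open>app_lam_vars\<close> is the beta rule at generic arguments. Composing it with the
  arrow that sends the variables to the \<open>a j\<close> gives the general rule, by naturality of
  \<open>app\<close>.\<close>

lemma app_lam:
  assumes h: "h \<in> Hom D (X @ replicate k 0) [0]" and a: "\<And>j. j < k \<Longrightarrow> a j \<in> Hom D X [0]"
  shows "app X k (lam X k h) (map a [0..<k]) = Cmp D X (X @ replicate k 0) [0] h (push X X k (Id D X) a)"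
proof -
  let ?X = "X @ replicate k 0" and ?p = "push X X k (Id D X) a"
  have p: "?p \<in> Hom D X ?X" by (intro push_in_Hom Id_in_Hom a)
  have "Cmp D X ?X [0] h ?p = Cmp D X ?X [0]
      (app ?X k (Cmp D ?X X [k] (lam X k h) (wkn X k)) (map (var X k) [0..<k])) ?p"
    by (simp add: app_lam_vars[OF h])
  also have "\<dots> = app X k (Cmp D X ?X [k] (Cmp D ?X X [k] (lam X k h) (wkn X k)) ?p)
      (map (\<lambda>a. Cmp D X ?X [0] a ?p) (map (var X k) [0..<k]))"
    by (rule app_Cmp[OF Cmp_in_Hom[OF wkn_in_Hom lam_in_Hom[OF h]] homs_vars p])
  also have "map (\<lambda>a. Cmp D X ?X [0] a ?p) (map (var X k) [0..<k]) = map a [0..<k]"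
    using var_push[OF Id_in_Hom a] by simp
  also have "Cmp D X ?X [k] (Cmp D ?X X [k] (lam X k h) (wkn X k)) ?p = lam X k h"
    using wkn_push[OF Id_in_Hom a]
    by (simp add: Cmp_assoc[OF p wkn_in_Hom lam_in_Hom[OF h], symmetric] Cmp_Id_right[OF lam_in_Hom[OF h]])
  finally show ?thesis ..
qed

text \<open>Both sides have the same value at the generic variables, and \<open>lam_app_vars\<close>
  recovers an element from that value.\<close>

lemma lam_Cmp:
  assumes h: "h \<in> Hom D (X @ replicate k 0) [0]" and \<sigma>: "\<sigma> \<in> Hom D Y X"
  shows "Cmp D Y X [k] (lam X k h) \<sigma> =
    lam Y k (Cmp D (Y @ replicate k 0) (X @ replicate k 0) [0] h (lift_arr Y X k \<sigma>))"
proof -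
  let ?X = "X @ replicate k 0" and ?Y = "Y @ replicate k 0" and ?s = "lift_arr Y X k \<sigma>"
  have s: "?s \<in> Hom D ?Y ?X" by (rule lift_arr_in_Hom[OF \<sigma>])
  have g: "Cmp D Y X [k] (lam X k h) \<sigma> \<in> Hom D Y [k]" by (intro Cmp_in_Hom[OF \<sigma>] lam_in_Hom h)
  have "Cmp D ?Y ?X [0] h ?s = Cmp D ?Y ?X [0]
      (app ?X k (Cmp D ?X X [k] (lam X k h) (wkn X k)) (map (var X k) [0..<k])) ?s"
    by (simp add: app_lam_vars[OF h])
  also have "\<dots> = app ?Y k (Cmp D ?Y ?X [k] (Cmp D ?X X [k] (lam X k h) (wkn X k)) ?s)
      (map (\<lambda>a. Cmp D ?Y ?X [0] a ?s) (map (var X k) [0..<k]))"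
    by (rule app_Cmp[OF Cmp_in_Hom[OF wkn_in_Hom lam_in_Hom[OF h]] homs_vars s])
  also have "map (\<lambda>a. Cmp D ?Y ?X [0] a ?s) (map (var X k) [0..<k]) = map (var Y k) [0..<k]"
    using var_lift_arr[OF \<sigma>] by simp
  also have "Cmp D ?Y ?X [k] (Cmp D ?X X [k] (lam X k h) (wkn X k)) ?s =
      Cmp D ?Y Y [k] (Cmp D Y X [k] (lam X k h) \<sigma>) (wkn Y k)"
    using wkn_lift_arr[OF \<sigma>]
    by (simp add: Cmp_assoc[OF s wkn_in_Hom lam_in_Hom[OF h], symmetric]
        Cmp_assoc[OF wkn_in_Hom \<sigma> lam_in_Hom[OF h], symmetric])
  finally show ?thesis using lam_app_vars[OF g] by simp
qed

lemma lam_0: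
  assumes "h \<in> Hom D X [0]"
  shows "lam X 0 h = h"
  using lam_app_vars[OF assms] assms by (simp add: app_0 Cmp_Id_right)

section \<open>Interpretation of the internal language\<close>

lemma Ops_internal_language [simp]:
  "(ms, n, f) \<in> Ops (internal_language D T) \<longleftrightarrow> f \<in> Hom D ms [n]"
  and Ar_internal_language [simp]: "Ar (internal_language D T) (ms, n, f) = ms @ replicate n 0"
  by (simp_all add: internal_language_def)

abbreviation "wf_il \<equiv> wf_tm (internal_language D T)"

text \<open>The trailing arguments stand at the places where \<open>op_tm\<close> has its variables,
  so the value of \<open>f\<close> is evaluated at them.\<close>

definition op_val :: "nat list \<Rightarrow> nat list \<times> nat \<times> 'a \<Rightarrow> 'a list \<Rightarrow> 'a" where
  "op_val X c as = (case c of (ms, n, f) \<Rightarrow>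
     app X n (Cmp D X ms [n] f (tup X ms (take (length ms) as))) (drop (length ms) as))"

lemma op_val_append:
  "length as = length ms \<Longrightarrow> op_val X (ms, n, f) (as @ bs) = app X n (Cmp D X ms [n] f (tup X ms as)) bs"
  by (simp add: op_val_def)

lemma homs_appendE:
  assumes "homs X (ms @ ns) fs"
  obtains gs hs where "fs = gs @ hs" "homs X ms gs" "homs X ns hs"
proof
  have l: "length (take (length ms) fs) = length ms" using assms by (simp add: homs_def)
  show "fs = take (length ms) fs @ drop (length ms) fs" by simp
  then have "homs X (ms @ ns) (take (length ms) fs @ drop (length ms) fs)" using assms by simp
  then show "homs X ms (take (length ms) fs)" "homs X ns (drop (length ms) fs)"
    unfolding homs_append[OF l] by blast+
qed

lemma homs_map: "homs X (map g xs) (map h xs) \<longleftrightarrow> (\<forall>x \<in> set xs. h x \<in> Hom D X [g x])"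
  by (auto simp: homs_def all_set_conv_all_nth)

lemma homs_length: "homs X ns fs \<Longrightarrow> length fs = length ns"
  by (simp add: homs_def)

lemma op_val_in_Hom:
  assumes "c \<in> Ops (internal_language D T)" "homs X (Ar (internal_language D T) c) as"
  shows "op_val X c as \<in> Hom D X [0]"
proof -
  obtain ms n f where c: "c = (ms, n, f)" by (cases c)
  from assms(2) obtain gs hs where "as = gs @ hs" "homs X ms gs" "homs X (replicate n 0) hs"
    unfolding c Ar_internal_language by (rule homs_appendE)
  with assms(1) c show ?thesis
    by (auto simp: op_val_append homs_length intro!: app_in_Hom Cmp_in_Hom[OF tup_in_Hom])
qed

lemma op_val_Cmp:
  assumes "c \<in> Ops (internal_language D T)" "homs X (Ar (internal_language D T) c) as" "\<sigma> \<in> Hom D Y X"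
  shows "Cmp D Y X [0] (op_val X c as) \<sigma> =
    op_val Y c (map2 (\<lambda>n a. Cmp D Y X [n] a \<sigma>) (Ar (internal_language D T) c) as)"
proof -
  obtain ms n f where c: "c = (ms, n, f)" by (cases c)
  from assms(2) obtain gs hs where as: "as = gs @ hs" and gs: "homs X ms gs" and hs: "homs X (replicate n 0) hs"
    unfolding c Ar_internal_language by (rule homs_appendE)
  have f: "f \<in> Hom D ms [n]" using assms(1) c by simp
  have l: "length gs = length ms" "length hs = n" using gs hs by (simp_all add: homs_def)
  have "map (\<lambda>i. Cmp D Y X [ms ! i] (gs ! i) \<sigma>) [0..<length ms] =
      map2 (\<lambda>n a. Cmp D Y X [n] a \<sigma>) ms gs"
    "map (\<lambda>a. Cmp D Y X [0] a \<sigma>) hs = map2 (\<lambda>n a. Cmp D Y X [n] a \<sigma>) (replicate n 0) hs"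
    using l by (auto intro!: nth_equalityI)
  then show ?thesis
    using app_Cmp[OF Cmp_in_Hom[OF tup_in_Hom[OF gs] f] hs assms(3)] tup_Cmp[OF gs assms(3)] l
    by (simp add: c as op_val_append Cmp_assoc[OF assms(3) tup_in_Hom[OF gs] f, symmetric])
qed

text \<open>At stage \<open>X\<close>, an environment for \<open>\<Theta> \<rhd> x\<^sub>1, \<dots>, x\<^sub>n\<close> assigns to the metavariables generalized
  elements \<open>M l \<in> Hom D X [\<Theta> ! l]\<close> and to the variables \<open>v i \<in> Hom D X [0]\<close>. Under a binder of \<open>k\<close>
  variables the stage is extended by \<open>[0]\<close>, \<open>k\<close> times.\<close>

definition env :: "nat list \<Rightarrow> nat \<Rightarrow> nat list \<Rightarrow> (nat \<Rightarrow> 'a) \<Rightarrow> (nat \<Rightarrow> 'a) \<Rightarrow> bool" where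
  "env \<Theta> n X M v \<longleftrightarrow>
     (\<forall>l < length \<Theta>. M l \<in> Hom D X [\<Theta> ! l]) \<and> (\<forall>i < n. v i \<in> Hom D X [0])"

definition lift_mvars :: "nat list \<Rightarrow> nat list \<Rightarrow> nat \<Rightarrow> (nat \<Rightarrow> 'a) \<Rightarrow> nat \<Rightarrow> 'a" where
  "lift_mvars \<Theta> X k M l = Cmp D (X @ replicate k 0) X [\<Theta> ! l] (M l) (wkn X k)"

definition lift_vars :: "nat list \<Rightarrow> nat \<Rightarrow> (nat \<Rightarrow> 'a) \<Rightarrow> nat \<Rightarrow> 'a" where
  "lift_vars X k v i =
     (if i < k then var X k i else Cmp D (X @ replicate k 0) X [0] (v (i - k)) (wkn X k))"

fun interp :: "nat list \<Rightarrow> nat list \<Rightarrow> (nat \<Rightarrow> 'a) \<Rightarrow> (nat \<Rightarrow> 'a) \<Rightarrow> (nat list \<times> nat \<times> 'a) tm \<Rightarrow> 'a" where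
  "interp \<Theta> X M v (Var i) = v i"
| "interp \<Theta> X M v (MVar l ss) = app X (\<Theta> ! l) (M l) (map (interp \<Theta> X M v) ss)"
| "interp \<Theta> X M v (Op c bs) = op_val X c (map (\<lambda>(k, t).
     lam X k (interp \<Theta> (X @ replicate k 0) (lift_mvars \<Theta> X k M) (lift_vars X k v) t)) bs)"

lemma env_lift:
  assumes "env \<Theta> n X M v"
  shows "env \<Theta> (n + k) (X @ replicate k 0) (lift_mvars \<Theta> X k M) (lift_vars X k v)"
  using assms by (auto simp: env_def lift_mvars_def lift_vars_def
      intro!: var_in_Hom Cmp_in_Hom[OF wkn_in_Hom])

lemma interp_in_Hom:
  assumes "wf_il \<Theta> n t" "env \<Theta> n X M v"
  shows "interp \<Theta> X M v t \<in> Hom D X [0]"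
  using assms
proof (induction arbitrary: X M v rule: wf_tm.induct)
  case (wf_MVar l ss n)
  then show ?case
    by (auto simp: env_def homs_replicate intro!: app_in_Hom)
next
  case (wf_Op c bs n)
  have "interp \<Theta> (X @ replicate k 0) (lift_mvars \<Theta> X k M) (lift_vars X k v) t
      \<in> Hom D (X @ replicate k 0) [0]" if "(k, t) \<in> set bs" for k t
    using wf_Op.IH that env_lift[OF wf_Op.prems] by blast
  then show ?case unfolding interp.simps
    by (intro op_val_in_Hom wf_Op.hyps(1)) (auto simp: wf_Op.hyps(2)[symmetric] homs_map intro!: lam_in_Hom)
qed (simp add: env_def)

text \<open>Environments are total functions, but facts about them hold only within the context;
  comparisons are therefore restricted to the indices that can occur.\<close>

lemma interp_cong:
  assumes "wf_il \<Theta> n t" "\<And>l. l < length \<Theta> \<Longrightarrow> M l = M' l" "\<And>i. i < n \<Longrightarrow> v i = v' i"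
  shows "interp \<Theta> X M v t = interp \<Theta> X M' v' t"
  using assms
proof (induction arbitrary: X M v M' v' rule: wf_tm.induct)
  case (wf_MVar l ss n)
  then have "interp \<Theta> X M v s = interp \<Theta> X M' v' s" if "s \<in> set ss" for s
    using that by blast
  then have "map (interp \<Theta> X M v) ss = map (interp \<Theta> X M' v') ss" by simp
  then show ?case using wf_MVar.hyps wf_MVar.prems by (simp only: interp.simps)
next
  case (wf_Op c bs n)
  have "interp \<Theta> (X @ replicate k 0) (lift_mvars \<Theta> X k M) (lift_vars X k v) t =
      interp \<Theta> (X @ replicate k 0) (lift_mvars \<Theta> X k M') (lift_vars X k v') t" if "(k, t) \<in> set bs" for k t
  proof -
    have IH: "\<And>M v M' v'. (\<And>l. l < length \<Theta> \<Longrightarrow> M l = M' l) \<Longrightarrow> (\<And>i. i < n + k \<Longrightarrow> v i = v' i) \<Longrightarrow>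
      interp \<Theta> (X @ replicate k 0) M v t = interp \<Theta> (X @ replicate k 0) M' v' t"
      using wf_Op.IH that by blast
    show ?thesis
      by (rule IH) (use wf_Op.prems in \<open>simp_all add: lift_mvars_def lift_vars_def\<close>)
  qed
  then show ?case by (auto intro!: arg_cong[where f = "op_val X c"])
qed simp

lemma lift_mvars_lift_arr:
  assumes "M l \<in> Hom D X [\<Theta> ! l]" "\<sigma> \<in> Hom D Y X"
  shows "Cmp D (Y @ replicate k 0) (X @ replicate k 0) [\<Theta> ! l] (lift_mvars \<Theta> X k M l) (lift_arr Y X k \<sigma>) =
    lift_mvars \<Theta> Y k (\<lambda>l. Cmp D Y X [\<Theta> ! l] (M l) \<sigma>) l"
  using assms
  by (simp add: lift_mvars_def Cmp_assoc[OF lift_arr_in_Hom wkn_in_Hom, symmetric] wkn_lift_arr)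
    (simp add: Cmp_assoc[OF wkn_in_Hom])

lemma lift_vars_lift_arr:
  assumes "k \<le> i \<Longrightarrow> v (i - k) \<in> Hom D X [0]" "\<sigma> \<in> Hom D Y X"
  shows "Cmp D (Y @ replicate k 0) (X @ replicate k 0) [0] (lift_vars X k v i) (lift_arr Y X k \<sigma>) =
    lift_vars Y k (\<lambda>i. Cmp D Y X [0] (v i) \<sigma>) i"
  using assms
  by (simp add: lift_vars_def Cmp_assoc[OF lift_arr_in_Hom wkn_in_Hom, symmetric] wkn_lift_arr var_lift_arr)
    (simp add: Cmp_assoc[OF wkn_in_Hom])

text \<open>Naturality in the stage, with \<open>lam_Cmp\<close> for the binders. It makes the value
  of a weakened term a restriction along \<open>wkn\<close>, and the value after instantiating bound
  variables a restriction along \<open>push\<close>.\<close>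

lemma interp_Cmp:
  assumes "wf_il \<Theta> n t" "env \<Theta> n X M v" "\<sigma> \<in> Hom D Y X"
  shows "Cmp D Y X [0] (interp \<Theta> X M v t) \<sigma> =
    interp \<Theta> Y (\<lambda>l. Cmp D Y X [\<Theta> ! l] (M l) \<sigma>) (\<lambda>i. Cmp D Y X [0] (v i) \<sigma>) t"
  using assms
proof (induction arbitrary: X Y M v \<sigma> rule: wf_tm.induct)
  case (wf_MVar l ss n)
  have "M l \<in> Hom D X [\<Theta> ! l]" "homs X (replicate (\<Theta> ! l) 0) (map (interp \<Theta> X M v) ss)"
    using wf_MVar by (auto simp: env_def homs_replicate intro!: interp_in_Hom[of _ n])
  then show ?case using wf_MVar app_Cmp[of "M l" X "\<Theta> ! l" "map (interp \<Theta> X M v) ss"]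
    by (auto simp: comp_def cong: map_cong)
next
  case (wf_Op c bs n)
  let ?M = "\<lambda>l. Cmp D Y X [\<Theta> ! l] (M l) \<sigma>" and ?v = "\<lambda>i. Cmp D Y X [0] (v i) \<sigma>"
  let ?I = "\<lambda>k t. interp \<Theta> (X @ replicate k 0) (lift_mvars \<Theta> X k M) (lift_vars X k v) t"
  have I: "?I k t \<in> Hom D (X @ replicate k 0) [0]" if "(k, t) \<in> set bs" for k t
    using wf_Op that by (auto intro!: interp_in_Hom[of _ "n + k"] env_lift)
  have eq: "Cmp D Y X [k] (lam X k (?I k t)) \<sigma> =
      lam Y k (interp \<Theta> (Y @ replicate k 0) (lift_mvars \<Theta> Y k ?M) (lift_vars Y k ?v) t)"
    if b: "(k, t) \<in> set bs" for k t
  proof -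
    let ?s = "lift_arr Y X k \<sigma>" and ?X = "X @ replicate k 0" and ?Y = "Y @ replicate k 0"
    have t: "wf_il \<Theta> (n + k) t" using wf_Op.IH b by blast
    have "Cmp D ?Y ?X [0] (?I k t) ?s = interp \<Theta> ?Y (\<lambda>l. Cmp D ?Y ?X [\<Theta> ! l] (lift_mvars \<Theta> X k M l) ?s)
        (\<lambda>i. Cmp D ?Y ?X [0] (lift_vars X k v i) ?s) t"
      using wf_Op.IH b env_lift[OF wf_Op.prems(1)] lift_arr_in_Hom[OF wf_Op.prems(2)] by blast
    also have "\<dots> = interp \<Theta> ?Y (lift_mvars \<Theta> Y k ?M) (lift_vars Y k ?v) t"
      by (rule interp_cong[OF t])
        (use wf_Op.prems in \<open>auto simp: env_def intro!: lift_mvars_lift_arr lift_vars_lift_arr\<close>)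
    finally show ?thesis using lam_Cmp[OF I[OF b] wf_Op.prems(2)] by simp
  qed
  let ?as = "map (\<lambda>(k, t). lam X k (?I k t)) bs"
  have "homs X (Ar (internal_language D T) c) ?as"
    using I by (auto simp: wf_Op.hyps(2)[symmetric] homs_map intro!: lam_in_Hom)
  from op_val_Cmp[OF wf_Op.hyps(1) this wf_Op.prems(2)] show ?case
    using eq by (auto simp: wf_Op.hyps(2)[symmetric] zip_map_map zip_same_conv_map comp_def case_prod_beta
        intro!: arg_cong[where f = "op_val Y c"])
qed simp

lemma interp_ren: "interp \<Theta> X M v (ren \<rho> t) = interp \<Theta> X M (\<lambda>i. v (\<rho> i)) t"
proof (induction \<rho> t arbitrary: X M v rule: ren.induct)
  case (3 \<rho> c bs)
  have *: "(\<lambda>i. lift_vars X k v (lift_ren k \<rho> i)) = lift_vars X k (\<lambda>i. v (\<rho> i))" for k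
    by (auto simp: lift_vars_def lift_ren_def)
  show ?case by (auto simp: * 3 intro!: arg_cong[where f = "op_val X c"])
qed (auto cong: map_cong)

lemma interp_sub:
  assumes "wf_il \<Theta> n t" "\<And>i. i < n \<Longrightarrow> wf_il \<Theta> n' (\<sigma> i)" "env \<Theta> n' X M v"
  shows "interp \<Theta> X M v (sub \<sigma> t) = interp \<Theta> X M (\<lambda>i. interp \<Theta> X M v (\<sigma> i)) t"
  using assms
proof (induction arbitrary: X M v \<sigma> n' rule: wf_tm.induct)
  case (wf_MVar l ss n)
  have "interp \<Theta> X M v (sub \<sigma> s) = interp \<Theta> X M (\<lambda>i. interp \<Theta> X M v (\<sigma> i)) s" if "s \<in> set ss" for s
    using wf_MVar that by blast
  then show ?case by (auto cong: map_cong)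
next
  case (wf_Op c bs n)
  have "interp \<Theta> (X @ replicate k 0) (lift_mvars \<Theta> X k M) (lift_vars X k v) (sub (lift_sub k \<sigma>) t) =
     interp \<Theta> (X @ replicate k 0) (lift_mvars \<Theta> X k M) (lift_vars X k (\<lambda>i. interp \<Theta> X M v (\<sigma> i))) t"
    if b: "(k, t) \<in> set bs" for k t
  proof -
    let ?X = "X @ replicate k 0"
    have t: "wf_il \<Theta> (n + k) t" using wf_Op.IH b by blast
    have s: "wf_il \<Theta> (n' + k) (lift_sub k \<sigma> i)" if "i < n + k" for i
      using that wf_Op.prems(1)[of "i - k"]
      by (cases "i < k") (auto intro: wf_tm.intros intro!: wf_ren[where n = n'])
    have "interp \<Theta> ?X (lift_mvars \<Theta> X k M) (lift_vars X k v) (sub (lift_sub k \<sigma>) t) =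
      interp \<Theta> ?X (lift_mvars \<Theta> X k M)
        (\<lambda>i. interp \<Theta> ?X (lift_mvars \<Theta> X k M) (lift_vars X k v) (lift_sub k \<sigma> i)) t"
      using wf_Op.IH b s env_lift[OF wf_Op.prems(2)] by blast
    also have "\<dots> = interp \<Theta> ?X (lift_mvars \<Theta> X k M) (lift_vars X k (\<lambda>i. interp \<Theta> X M v (\<sigma> i))) t"
    proof (rule interp_cong[OF t])
      fix i assume i: "i < n + k"
      show "interp \<Theta> ?X (lift_mvars \<Theta> X k M) (lift_vars X k v) (lift_sub k \<sigma> i) =
        lift_vars X k (\<lambda>i. interp \<Theta> X M v (\<sigma> i)) i"
      proof (cases "i < k")
        case True
        then show ?thesis by (simp add: lift_vars_def)
      next
        case False
        \<comment> \<open>A term moved under the binder has as value its old value composed with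
          \<open>wkn\<close>.\<close>
        then have "wf_il \<Theta> n' (\<sigma> (i - k))" using wf_Op.prems(1) i by simp
        from interp_Cmp[OF this wf_Op.prems(2) wkn_in_Hom] False show ?thesis
          by (simp add: interp_ren lift_vars_def lift_mvars_def[abs_def])
      qed
    qed simp
    finally show ?thesis .
  qed
  then show ?case by (auto intro!: arg_cong[where f = "op_val X c"])
qed simp

text \<open>Beta in the model: \<open>app_lam\<close> turns the application into restriction along
  the arrow \<open>?p\<close>, which gives the bound variables the values of \<open>us\<close>. Then
  \<open>interp_Cmp\<close> moves this restriction into the environment, and
  \<open>interp_sub\<close> identifies the result as a substitution.\<close>

lemma interp_inst:
  assumes t: "wf_il \<Theta> (n + m) t" and us: "length us = m" "\<And>u. u \<in> set us \<Longrightarrow> wf_il \<Theta> n u"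
    and e: "env \<Theta> n X M v"
  shows "interp \<Theta> X M v (inst (m, t) us) =
    app X m (lam X m (interp \<Theta> (X @ replicate m 0) (lift_mvars \<Theta> X m M) (lift_vars X m v) t))
      (map (interp \<Theta> X M v) us)"
proof -
  let ?a = "\<lambda>j. interp \<Theta> X M v (us ! j)" and ?X = "X @ replicate m 0"
  let ?p = "push X X m (Id D X) ?a"
  have a: "?a j \<in> Hom D X [0]" if "j < m" for j
    using that us by (intro interp_in_Hom[OF _ e]) simp
  have p: "?p \<in> Hom D X ?X" by (intro push_in_Hom Id_in_Hom a)
  have M: "M l \<in> Hom D X [\<Theta> ! l]" if "l < length \<Theta>" for l using e that by (simp add: env_def)
  have v: "v i \<in> Hom D X [0]" if "i < n" for i using e that by (simp add: env_def)
  have w: "Cmp D X ?X X (wkn X m) ?p = Id D X" by (intro wkn_push Id_in_Hom a)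
  have "map ?a [0..<m] = map (interp \<Theta> X M v) us"
    using us(1) by (intro nth_equalityI) auto
  then have "app X m (lam X m (interp \<Theta> ?X (lift_mvars \<Theta> X m M) (lift_vars X m v) t)) (map (interp \<Theta> X M v) us)
    = Cmp D X ?X [0] (interp \<Theta> ?X (lift_mvars \<Theta> X m M) (lift_vars X m v) t) ?p"
    using app_lam[OF interp_in_Hom[OF t env_lift[OF e]], of ?a] a by simp
  also have "\<dots> = interp \<Theta> X (\<lambda>l. Cmp D X ?X [\<Theta> ! l] (lift_mvars \<Theta> X m M l) ?p)
      (\<lambda>i. Cmp D X ?X [0] (lift_vars X m v i) ?p) t"
    by (rule interp_Cmp[OF t env_lift[OF e] p])
  also have "\<dots> = interp \<Theta> X M (\<lambda>i. interp \<Theta> X M v (if i < m then us ! i else Var (i - m))) t"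
  proof (rule interp_cong[OF t])
    show "Cmp D X ?X [\<Theta> ! l] (lift_mvars \<Theta> X m M l) ?p = M l" if "l < length \<Theta>" for l
      using M[OF that]
      by (simp add: lift_mvars_def Cmp_assoc[OF p wkn_in_Hom, symmetric] w Cmp_Id_right)
    show "Cmp D X ?X [0] (lift_vars X m v i) ?p = interp \<Theta> X M v (if i < m then us ! i else Var (i - m))"
      if "i < n + m" for i
      using v[of "i - m"] that var_push[OF Id_in_Hom a]
      by (auto simp: lift_vars_def Cmp_assoc[OF p wkn_in_Hom, symmetric] w Cmp_Id_right)
  qed
  also have "\<dots> = interp \<Theta> X M v (inst (m, t) us)"
    unfolding inst_def split
    by (rule interp_sub[OF t _ e, symmetric]) (use us in \<open>auto intro!: wf_tm.intros\<close>)
  finally show ?thesis ..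
qed

section \<open>Values of abstractions, and metasubstitution\<close>

definition abs_val :: "nat list \<Rightarrow> nat list \<Rightarrow> (nat \<Rightarrow> 'a) \<Rightarrow> (nat \<Rightarrow> 'a) \<Rightarrow> nat \<times> (nat list \<times> nat \<times> 'a) tm \<Rightarrow> 'a" where
  "abs_val \<Theta> X M v b = (case b of (m, t) \<Rightarrow>
     lam X m (interp \<Theta> (X @ replicate m 0) (lift_mvars \<Theta> X m M) (lift_vars X m v) t))"

text \<open>\<open>weaken_abs\<close> keeps the bound indices and shifts the others past the
  \<open>k\<close> new variables. On values this is restriction along \<open>wkn\<close>, by
  naturality of \<open>lam\<close> and of \<open>interp\<close>.\<close>

lemma abs_val_weaken:
  assumes t: "wf_il \<Theta> (n + m) t" and e: "env \<Theta> n X M v"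
  shows "abs_val \<Theta> (X @ replicate k 0) (lift_mvars \<Theta> X k M) (lift_vars X k v) (weaken_abs k (m, t)) =
    Cmp D (X @ replicate k 0) X [m] (abs_val \<Theta> X M v (m, t)) (wkn X k)"
proof -
  let ?X = "X @ replicate k 0"
  have *: "lift_vars ?X m (lift_vars X k v) (lift_ren m (\<lambda>j. j + k) i) =
      lift_vars ?X m (\<lambda>i. Cmp D ?X X [0] (v i) (wkn X k)) i" for i
    by (auto simp: lift_ren_def lift_vars_def)
  have "Cmp D ?X X [m] (abs_val \<Theta> X M v (m, t)) (wkn X k) =
    lam ?X m (Cmp D (?X @ replicate m 0) (X @ replicate m 0) [0]
      (interp \<Theta> (X @ replicate m 0) (lift_mvars \<Theta> X m M) (lift_vars X m v) t) (lift_arr ?X X m (wkn X k)))"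
    unfolding abs_val_def split by (rule lam_Cmp[OF interp_in_Hom[OF t env_lift[OF e]] wkn_in_Hom])
  also have "Cmp D (?X @ replicate m 0) (X @ replicate m 0) [0]
      (interp \<Theta> (X @ replicate m 0) (lift_mvars \<Theta> X m M) (lift_vars X m v) t) (lift_arr ?X X m (wkn X k)) =
    interp \<Theta> (?X @ replicate m 0)
      (\<lambda>l. Cmp D (?X @ replicate m 0) (X @ replicate m 0) [\<Theta> ! l] (lift_mvars \<Theta> X m M l) (lift_arr ?X X m (wkn X k)))
      (\<lambda>i. Cmp D (?X @ replicate m 0) (X @ replicate m 0) [0] (lift_vars X m v i) (lift_arr ?X X m (wkn X k))) t"
    by (rule interp_Cmp[OF t env_lift[OF e] lift_arr_in_Hom[OF wkn_in_Hom]])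
  also have "\<dots> = interp \<Theta> (?X @ replicate m 0) (lift_mvars \<Theta> ?X m (lift_mvars \<Theta> X k M))
      (\<lambda>i. lift_vars ?X m (lift_vars X k v) (lift_ren m (\<lambda>j. j + k) i)) t"
    by (rule interp_cong[OF t])
      (use e in \<open>auto simp: * env_def lift_mvars_lift_arr lift_vars_lift_arr wkn_in_Hom simp del: append_assoc\<close>,
       simp add: lift_mvars_def)
  finally show ?thesis by (simp add: abs_val_def weaken_abs_def interp_ren)
qed

lemma abs_val_in_Hom:
  assumes "wf_il \<Theta> (n + m) t" "env \<Theta> n X M v"
  shows "abs_val \<Theta> X M v (m, t) \<in> Hom D X [m]"
  unfolding abs_val_def split by (intro lam_in_Hom interp_in_Hom[OF assms(1)] env_lift assms(2))

text \<open>Stage and variables stay the same; only the context of metavariables changes, the new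
  values being those of the abstractions put in. Metavariables are handled by
  \<open>interp_inst\<close>, binders by \<open>abs_val_weaken\<close>.\<close>

lemma interp_msub:
  assumes "wf_il ms n t" "wf_abss (internal_language D T) \<Theta> n ms \<tau>" "env \<Theta> n X M v"
  shows "interp \<Theta> X M v (msub \<tau> t) = interp ms X (\<lambda>l. abs_val \<Theta> X M v (\<tau> ! l)) v t"
  using assms
proof (induction arbitrary: X M v \<tau> rule: wf_tm.induct)
  case (wf_MVar l ss n)
  then have l: "\<tau> ! l = (ms ! l, snd (\<tau> ! l))" "wf_il \<Theta> (n + ms ! l) (snd (\<tau> ! l))"
    by (auto simp: wf_abss_def prod_eq_iff)
  have "interp \<Theta> X M v (inst (ms ! l, snd (\<tau> ! l)) (map (msub \<tau>) ss)) =
    app X (ms ! l) (abs_val \<Theta> X M v (ms ! l, snd (\<tau> ! l))) (map (interp \<Theta> X M v) (map (msub \<tau>) ss))"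
    using wf_MVar unfolding abs_val_def split
    by (intro interp_inst[OF l(2)]) (auto intro!: wf_msub)
  moreover have "interp \<Theta> X M v (msub \<tau> s) = interp ms X (\<lambda>l. abs_val \<Theta> X M v (\<tau> ! l)) v s"
    if "s \<in> set ss" for s using wf_MVar that by blast
  ultimately show ?case using l(1) by (simp add: comp_def cong: map_cong)
next
  case (wf_Op c bs n)
  have "interp \<Theta> (X @ replicate k 0) (lift_mvars \<Theta> X k M) (lift_vars X k v) (msub (map (weaken_abs k) \<tau>) t) =
    interp ms (X @ replicate k 0) (lift_mvars ms X k (\<lambda>l. abs_val \<Theta> X M v (\<tau> ! l))) (lift_vars X k v) t"
    if b: "(k, t) \<in> set bs" for k t
  proof -
    have t: "wf_il ms (n + k) t" using wf_Op.IH b by blast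
    have "interp \<Theta> (X @ replicate k 0) (lift_mvars \<Theta> X k M) (lift_vars X k v) (msub (map (weaken_abs k) \<tau>) t) =
      interp ms (X @ replicate k 0)
        (\<lambda>l. abs_val \<Theta> (X @ replicate k 0) (lift_mvars \<Theta> X k M) (lift_vars X k v) (map (weaken_abs k) \<tau> ! l))
        (lift_vars X k v) t"
      using wf_Op.IH b wf_abss_weaken[OF wf_Op.prems(1)] env_lift[OF wf_Op.prems(2)] by blast
    also have "\<dots> = interp ms (X @ replicate k 0) (lift_mvars ms X k (\<lambda>l. abs_val \<Theta> X M v (\<tau> ! l))) (lift_vars X k v) t"
    proof (rule interp_cong[OF t])
      fix l assume "l < length ms"
      then have l: "l < length \<tau>" "\<tau> ! l = (ms ! l, snd (\<tau> ! l))" "wf_il \<Theta> (n + ms ! l) (snd (\<tau> ! l))"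
        using wf_Op.prems(1) by (auto simp: wf_abss_def prod_eq_iff)
      show "abs_val \<Theta> (X @ replicate k 0) (lift_mvars \<Theta> X k M) (lift_vars X k v) (map (weaken_abs k) \<tau> ! l) =
        lift_mvars ms X k (\<lambda>l. abs_val \<Theta> X M v (\<tau> ! l)) l"
        using abs_val_weaken[OF l(3) wf_Op.prems(2), of k] l(1,2) by (simp add: lift_mvars_def)
    qed simp
    finally show ?thesis .
  qed
  then show ?case by (auto intro!: arg_cong[where f = "op_val X c"])
qed simp

section \<open>Soundness\<close>

text \<open>The variables are first turned into further metavariables of arity 0 with values
  \<open>v\<close>. Then all subterms are closed and \<open>act_inst\<close> carries the induction;
  applied once more, to \<open>s\<close> itself, it separates the values of the variables
  again.\<close>

lemma interp_embed:
  assumes s: "wf_tm empty_sig \<Theta> n s" and e: "env \<Theta> n X M v"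
  shows "interp \<Theta> X M v (embed s) = app X n (act X \<Theta> n s (map M [0..<length \<Theta>])) (map v [0..<n])"
proof -
  define \<Psi> where "\<Psi> = \<Theta> @ replicate n 0"
  define Ms where "Ms = map M [0..<length \<Theta>]"
  define fs where "fs = Ms @ map v [0..<n]"
  define us :: "unit tm list" where "us = map (\<lambda>j. MVar (length \<Theta> + j) []) [0..<n]"
  define \<sigma> where "\<sigma> = (\<lambda>j. if j < n then us ! j else Var (j - n))"
  have Ms: "homs X \<Theta> Ms" using e by (simp add: env_def Ms_def homs_map_upt)
  have fs: "homs X \<Psi> fs"
    using e Ms by (auto simp: env_def \<Psi>_def fs_def homs_length homs_replicate)
  have \<Psi>: "length \<Psi> = length \<Theta> + n" "\<And>j. j < n \<Longrightarrow> \<Psi> ! (length \<Theta> + j) = 0"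
    "\<And>l. l < length \<Theta> \<Longrightarrow> \<Psi> ! l = \<Theta> ! l"
    by (simp_all add: \<Psi>_def nth_append)
  have fs_nth: "\<And>j. j < n \<Longrightarrow> fs ! (length \<Theta> + j) = v j" "\<And>l. l < length \<Theta> \<Longrightarrow> fs ! l = M l"
    by (simp_all add: fs_def Ms_def nth_append)
  have us: "length us = n" "\<And>j. j < n \<Longrightarrow> us ! j = MVar (length \<Theta> + j) []"
    "\<And>u. u \<in> set us \<Longrightarrow> wf_tm empty_sig \<Psi> 0 u"
    using \<Psi> by (auto simp: us_def intro!: wf_tm.intros)
  have closed: "wf_tm empty_sig \<Psi> 0 (sub \<sigma> t)" if "wf_tm empty_sig \<Theta> n t" for t
    using wf_append[OF that, of "replicate n 0"] us(1,3)
    by (auto simp: \<Psi>_def[symmetric] \<sigma>_def intro!: wf_sub[of _ _ n])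
  have "interp \<Theta> X M v (embed s) = act X \<Psi> 0 (sub \<sigma> s) fs"
    using s closed
  proof (induction s rule: tm.induct)
    case (Var i)
    then show ?case
      using \<Psi> fs_nth us act_mvar_0[OF fs, of "length \<Theta> + i"]
      by (auto simp: \<sigma>_def elim: wf_tm.cases)
  next
    case (MVar l ss)
    from MVar.prems(1) have ss: "l < length \<Theta>" "length ss = \<Theta> ! l" "\<And>s. s \<in> set ss \<Longrightarrow> wf_tm empty_sig \<Theta> n s"
      by (auto elim: wf_tm.cases)
    have "act X \<Psi> 0 (inst (\<Theta> ! l, eta_mvar l (\<Theta> ! l)) (map (sub \<sigma>) ss)) fs =
      app X (\<Theta> ! l) (act X \<Psi> (\<Theta> ! l) (eta_mvar l (\<Theta> ! l)) fs) (map (\<lambda>u. act X \<Psi> 0 u fs) (map (sub \<sigma>) ss))"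
      by (rule act_inst) (use ss closed \<Psi> fs in \<open>auto intro!: wf_eta_mvar\<close>)
    moreover have "act X \<Psi> (\<Theta> ! l) (eta_mvar l (\<Theta> ! l)) fs = M l"
      using act_eta_mvar[OF fs, of l] \<Psi> ss(1) fs_nth by simp
    moreover have "interp \<Theta> X M v (embed s) = act X \<Psi> 0 (sub \<sigma> s) fs" if "s \<in> set ss" for s
      using MVar.IH[OF that] ss(3)[OF that] closed by blast
    ultimately show ?case using ss(2) by (simp add: comp_def cong: map_cong)
  next
    case (Op c bs)
    from Op.prems(1) show ?case by (cases rule: wf_tm.cases) (simp add: empty_sig_def)
  qed
  also have "\<dots> = act X \<Psi> 0 (inst (n, s) us) fs" by (simp add: inst_def \<sigma>_def)
  also have "\<dots> = app X n (act X \<Psi> n s fs) (map (\<lambda>u. act X \<Psi> 0 u fs) us)"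
    using wf_append[OF s] us fs by (intro act_inst) (auto simp: \<Psi>_def)
  also have "map (\<lambda>u. act X \<Psi> 0 u fs) us = map v [0..<n]"
    using us fs_nth \<Psi> by (intro nth_equalityI) (auto simp: act_mvar_0[OF fs])
  \<comment> \<open>\<open>s\<close> does not mention the added metavariables. The identity
    metasubstitution, read as going from \<Theta> to \<open>\<Psi>\<close>, discards them.\<close>
  also have "act X \<Psi> n s fs = act X \<Theta> n s Ms"
  proof -
    let ?es = "map (\<lambda>i. eta_mvar i (\<Theta> ! i)) [0..<length \<Theta>] :: unit tm list"
    have "msub (zip \<Theta> ?es) s = s" by (rule msub_eta_mvars[OF s]) simp
    moreover have "map (\<lambda>i. act X \<Psi> (\<Theta> ! i) (?es ! i) fs) [0..<length \<Theta>] = Ms"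
      using \<Psi> fs_nth by (intro nth_equalityI) (auto simp: act_eta_mvar[OF fs] Ms_def)
    ultimately show ?thesis
      using act_msub[OF s, of ?es \<Psi> X fs] fs \<Psi> by (simp add: wf_eta_mvar)
  qed
  finally show ?thesis by (simp add: Ms_def)
qed

lemma wf_op_tm: "f \<in> Hom D ms [n] \<Longrightarrow> wf_il ms n (op_tm ms n f)"
  by (auto simp: op_tm_def comp_def map_replicate_const map_nth intro!: wf_tm.wf_Op wf_eta_mvar wf_tm.wf_Var)

lemma map_lift_vars [simp]: "map (lift_vars X m v) [0..<m] = map (var X m) [0..<m]"
  by (simp add: lift_vars_def)

text \<open>Abstracting a metavariable applied to the bound variables gives back its value, by
  \<open>lam_app_vars\<close>; the trailing arguments bind nothing, and \<open>lam_0\<close> applies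
  to them.\<close>

lemma interp_op_tm:
  assumes f: "f \<in> Hom D ms [n]" and e: "env ms n X M v"
  shows "interp ms X M v (op_tm ms n f) =
    app X n (Cmp D X ms [n] f (tup X ms (map M [0..<length ms]))) (map v [0..<n])"
proof -
  have "lam X (ms ! i) (interp ms (X @ replicate (ms ! i) 0) (lift_mvars ms X (ms ! i) M)
      (lift_vars X (ms ! i) v) (eta_mvar i (ms ! i))) = M i" if "i < length ms" for i
    using lam_app_vars[of "M i" X "ms ! i"] e that
    by (simp add: eta_mvar_def comp_def env_def lift_mvars_def)
  moreover have "lam X 0 (lift_vars X 0 v j) = v j" if "j < n" for j
    using e that by (simp add: lift_vars_def env_def Cmp_Id_right lam_0)
  ultimately have eqs: "map (\<lambda>i. lam X (ms ! i) (interp ms (X @ replicate (ms ! i) 0) (lift_mvars ms X (ms ! i) M)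
      (lift_vars X (ms ! i) v) (eta_mvar i (ms ! i)))) [0..<length ms] = map M [0..<length ms]"
    "map (\<lambda>j. lam X 0 (lift_vars X 0 v j)) [0..<n] = map v [0..<n]"
    by simp_all
  show ?thesis by (simp add: op_tm_def op_val_def comp_def eqs)
qed

text \<open>Eta for the whole term: abstracting over the variables displayed in \<open>op_tm\<close>
  undoes the evaluation at them. With it the composition axioms become associativity of composition
  in \<open>D\<close>.\<close>

lemma abs_val_op_tm:
  assumes f: "f \<in> Hom D \<Theta> [m]" and e: "env \<Theta> n X M v"
  shows "abs_val \<Theta> X M v (m, op_tm \<Theta> m f) = Cmp D X \<Theta> [m] f (tup X \<Theta> (map M [0..<length \<Theta>]))"
proof -
  let ?Ms = "map M [0..<length \<Theta>]" and ?X = "X @ replicate m 0"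
  have Ms: "homs X \<Theta> ?Ms" using e by (simp add: env_def homs_map_upt)
  have t: "tup X \<Theta> ?Ms \<in> Hom D X \<Theta>" by (rule tup_in_Hom[OF Ms])
  have em: "env \<Theta> m ?X (lift_mvars \<Theta> X m M) (lift_vars X m v)"
    using env_lift[OF e] by (simp add: env_def)
  have "tup ?X \<Theta> (map (lift_mvars \<Theta> X m M) [0..<length \<Theta>]) =
    tup ?X \<Theta> (map (\<lambda>i. Cmp D ?X X [\<Theta> ! i] (?Ms ! i) (wkn X m)) [0..<length \<Theta>])"
    by (rule arg_cong[where f = "tup ?X \<Theta>"]) (simp add: lift_mvars_def)
  also have "\<dots> = Cmp D ?X X \<Theta> (tup X \<Theta> ?Ms) (wkn X m)"
    by (rule tup_Cmp[OF Ms wkn_in_Hom, symmetric])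
  finally have "interp \<Theta> ?X (lift_mvars \<Theta> X m M) (lift_vars X m v) (op_tm \<Theta> m f) =
    app ?X m (Cmp D ?X X [m] (Cmp D X \<Theta> [m] f (tup X \<Theta> ?Ms)) (wkn X m)) (map (var X m) [0..<m])"
    using interp_op_tm[OF f em]
    by (simp add: Cmp_assoc[OF wkn_in_Hom t f, symmetric])
  then show ?thesis using lam_app_vars[OF Cmp_in_Hom[OF t f]] by (simp add: abs_val_def)
qed

lemma Axioms_internal_language_cases:
  assumes "(\<Theta>, n, s, t) \<in> Axioms (internal_language D T)"
  obtains (embed) u where "wf_tm empty_sig \<Theta> n u" "s = embed u" "t = op_tm \<Theta> n (farr T \<Theta> [n] [u])"
    | (Cmp) ns g fs where "g \<in> Hom D ns [n]" "homs \<Theta> ns fs"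
      "s = op_tm \<Theta> n (Cmp D \<Theta> ns [n] g (tup \<Theta> ns fs))"
      "t = msub (zip ns (map2 (op_tm \<Theta>) ns fs)) (op_tm ns n g)"
  using assms by (auto simp: internal_language_def homs_def)

abbreviation "derives \<equiv> derivable (internal_language D T)"

text \<open>Well-formedness is proved along because \<open>interp_msub\<close> needs it in the case
  of \<open>msubst\<close>. All stages are quantified over since in that case the terms put for
  metavariables are interpreted at extended stages.\<close>

lemma derives_sound:
  assumes "derives \<Theta> n s t"
  shows "wf_il \<Theta> n s \<and> wf_il \<Theta> n t \<and>
    (\<forall>X M v. env \<Theta> n X M v \<longrightarrow> interp \<Theta> X M v s = interp \<Theta> X M v t)"
  using assms
proof induction
  case (axiom \<Theta> n s t)
  then show ?case
  proof (cases rule: Axioms_internal_language_cases)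
    case (embed u)
    have "farr T \<Theta> [n] [u] \<in> Hom D \<Theta> [n]" using embed by (intro farr_in_Hom) simp
    then show ?thesis using embed
      by (auto simp: wf_embed wf_op_tm interp_embed interp_op_tm act_def)
  next
    case (Cmp ns g fs)
    let ?\<tau> = "zip ns (map2 (op_tm \<Theta>) ns fs)"
    have l: "length fs = length ns" using Cmp by (simp add: homs_def)
    have fs: "fs ! i \<in> Hom D \<Theta> [ns ! i]" if "i < length ns" for i using Cmp that by (simp add: homs_def)
    have tau: "wf_abss (internal_language D T) \<Theta> n' ns ?\<tau>" for n'
      using l by (auto intro!: wf_abss_zip wf_mono[OF wf_op_tm[OF fs]])
    have h: "Cmp D \<Theta> ns [n] g (tup \<Theta> ns fs) \<in> Hom D \<Theta> [n]"
      using Cmp by (intro Cmp_in_Hom[OF tup_in_Hom])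
    have "interp \<Theta> X M v s = interp \<Theta> X M v t" if e: "env \<Theta> n X M v" for X M v
    proof -
      let ?Ms = "map M [0..<length \<Theta>]"
      have Ms: "tup X \<Theta> ?Ms \<in> Hom D X \<Theta>"
        using e by (intro tup_in_Hom) (simp add: env_def homs_map_upt)
      have a: "abs_val \<Theta> X M v (?\<tau> ! i) = Cmp D X \<Theta> [ns ! i] (fs ! i) (tup X \<Theta> ?Ms)"
        if "i < length ns" for i
        using that l abs_val_op_tm[OF fs[OF that] e] by simp
      then have "env ns n X (\<lambda>l. abs_val \<Theta> X M v (?\<tau> ! l)) v"
        using e fs Ms by (auto simp: env_def intro!: Cmp_in_Hom[OF Ms])
      then have "interp \<Theta> X M v t = app X n (Cmp D X ns [n] g
          (tup X ns (map (\<lambda>l. abs_val \<Theta> X M v (?\<tau> ! l)) [0..<length ns]))) (map v [0..<n])"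
        unfolding Cmp(4) using interp_msub[OF wf_op_tm[OF Cmp(1)] tau e] interp_op_tm[OF Cmp(1)] by simp
      also have "tup X ns (map (\<lambda>l. abs_val \<Theta> X M v (?\<tau> ! l)) [0..<length ns]) =
          Cmp D X \<Theta> ns (tup \<Theta> ns fs) (tup X \<Theta> ?Ms)"
        unfolding tup_Cmp[OF Cmp(2) Ms] using a by (intro arg_cong[where f = "tup X ns"]) simp
      finally show ?thesis
        unfolding Cmp(3) using interp_op_tm[OF h e]
        by (simp add: Cmp_assoc[OF Ms tup_in_Hom[OF Cmp(2)] Cmp(1)])
    qed
    then show ?thesis using Cmp h by (auto simp: wf_op_tm intro!: wf_msub[OF wf_op_tm] tau)
  qed
next
  case (msubst ms g s t ss ts \<Theta> d)
  let ?s = "ren (\<lambda>j. j + d) s" and ?t = "ren (\<lambda>j. j + d) t"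
  have st: "wf_il ms (g + d) ?s" "wf_il ms (g + d) ?t"
    using msubst by (auto intro!: wf_ren[where n = g])
  have sts: "wf_il \<Theta> (d + ms ! i) (ss ! i)" "wf_il \<Theta> (d + ms ! i) (ts ! i)" if "i < length ms" for i
    using msubst that by blast+
  have l: "length ss = length ms" "length ts = length ms" using msubst by blast+
  have taus: "wf_abss (internal_language D T) \<Theta> (g + d) ms (zip ms ss)"
    "wf_abss (internal_language D T) \<Theta> (g + d) ms (zip ms ts)"
    by (rule wf_abss_zip[OF l(1)], rule wf_mono[OF sts(1)], simp_all)
      (rule wf_abss_zip[OF l(2)], rule wf_mono[OF sts(2)], simp_all)
  have IH: "interp \<Theta> X M v (ss ! i) = interp \<Theta> X M v (ts ! i)"
    if "i < length ms" "env \<Theta> (d + ms ! i) X M v" for i X M v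
    using msubst that by blast
  have "interp \<Theta> X M v (msub (zip ms ss) ?s) = interp \<Theta> X M v (msub (zip ms ts) ?t)"
    if e: "env \<Theta> (g + d) X M v" for X M v
  proof -
    \<comment> \<open>\<Delta> occupies the first \<open>d\<close> indices, so the
      \<open>ss ! i\<close> see only these values of \<open>v\<close>, while \<open>s\<close> sees
      the remaining ones as \<open>v (i + d)\<close>.\<close>
    have ed: "env \<Theta> d X M v" using e by (simp add: env_def)
    have eq: "abs_val \<Theta> X M v (zip ms ss ! i) = abs_val \<Theta> X M v (zip ms ts ! i)"
      and in_Hom: "abs_val \<Theta> X M v (zip ms ss ! i) \<in> Hom D X [ms ! i]" if "i < length ms" for i
      using that l IH[OF that env_lift[OF ed]] abs_val_in_Hom[OF sts(1)[OF that] ed]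
      by (simp_all add: abs_val_def)
    have eg: "env ms g X (\<lambda>l. abs_val \<Theta> X M v (zip ms ss ! l)) (\<lambda>i. v (i + d))"
      using e in_Hom by (auto simp: env_def)
    have "interp \<Theta> X M v (msub (zip ms ss) ?s) =
      interp ms X (\<lambda>l. abs_val \<Theta> X M v (zip ms ss ! l)) (\<lambda>i. v (i + d)) s"
      by (simp add: interp_msub[OF st(1) taus(1) e] interp_ren)
    also have "\<dots> = interp ms X (\<lambda>l. abs_val \<Theta> X M v (zip ms ss ! l)) (\<lambda>i. v (i + d)) t"
      using msubst eg by blast
    also have "\<dots> = interp ms X (\<lambda>l. abs_val \<Theta> X M v (zip ms ts ! l)) (\<lambda>i. v (i + d)) t"
      using msubst eq by (intro interp_cong[where n = g]) blast+
    also have "\<dots> = interp \<Theta> X M v (msub (zip ms ts) ?t)"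
      by (simp add: interp_msub[OF st(2) taus(2) e] interp_ren)
    finally show ?thesis .
  qed
  then show ?case using st taus by (blast intro: wf_msub)
qed auto

text \<open>Interpretation in the generic environment: the projections, restricted along
  \<open>wkn\<close>, for the metavariables, and the added factors of the stage for the variables.
  The tuple of the former is \<open>wkn \<Theta> n\<close>, so the two values are those from which
  \<open>lam_app_vars\<close> recovers \<open>f\<close> and \<open>g\<close>.\<close>

lemma derives_op_tm_inj:
  assumes d: "derives \<Theta> n (op_tm \<Theta> n f) (op_tm \<Theta> n g)" and f: "f \<in> Hom D \<Theta> [n]" and g: "g \<in> Hom D \<Theta> [n]"
  shows "f = g"
proof -
  let ?X = "\<Theta> @ replicate n 0"
  have e: "env \<Theta> n ?X (\<lambda>l. Cmp D ?X \<Theta> [\<Theta> ! l] (proj \<Theta> l) (wkn \<Theta> n)) (var \<Theta> n)"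
    by (auto simp: env_def intro!: Cmp_in_Hom[OF wkn_in_Hom] proj_in_Hom var_in_Hom)
  have "app ?X n (Cmp D ?X \<Theta> [n] f (wkn \<Theta> n)) (map (var \<Theta> n) [0..<n]) =
      app ?X n (Cmp D ?X \<Theta> [n] g (wkn \<Theta> n)) (map (var \<Theta> n) [0..<n])"
    using derives_sound[OF d] e interp_op_tm[OF f e] interp_op_tm[OF g e]
    by (simp add: tup_proj[OF wkn_in_Hom])
  then show ?thesis using lam_app_vars f g by metis
qed

section \<open>Completeness\<close>

definition rep :: "nat list \<Rightarrow> nat \<Rightarrow> (nat list \<times> nat \<times> 'a) tm \<Rightarrow> 'a \<Rightarrow> bool" where
  "rep \<Theta> n t f \<longleftrightarrow> f \<in> Hom D \<Theta> [n] \<and> derives \<Theta> n t (op_tm \<Theta> n f)"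

lemma rep_wf: "rep \<Theta> n t f \<Longrightarrow> wf_il \<Theta> n t"
  using derives_sound by (auto simp: rep_def)

lemma rep_op_tm: "f \<in> Hom D \<Theta> [n] \<Longrightarrow> rep \<Theta> n (op_tm \<Theta> n f) f"
  by (simp add: rep_def wf_op_tm derivable.refl)

lemma rep_embed: "wf_tm empty_sig \<Theta> n s \<Longrightarrow> rep \<Theta> n (embed s) (farr T \<Theta> [n] [s])"
  by (auto simp: rep_def internal_language_def intro!: farr_in_Hom derivable.axiom)

lemma rep_eta_mvar: "i < length \<Theta> \<Longrightarrow> m = \<Theta> ! i \<Longrightarrow> rep \<Theta> m (eta_mvar i m) (proj \<Theta> i)"
  using rep_embed[OF wf_eta_mvar[of i \<Theta> m m]] by (simp add: proj_def)

lemma Cmp_axiom: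
  assumes g: "g \<in> Hom D ms [n]" and fs: "homs \<Theta> ms fs"
  shows "derives \<Theta> n (op_tm \<Theta> n (Cmp D \<Theta> ms [n] g (tup \<Theta> ms fs)))
    (msub (zip ms (map2 (op_tm \<Theta>) ms fs)) (op_tm ms n g))"
proof (rule derivable.axiom)
  have "Cmp D \<Theta> ms [n] g (tup \<Theta> ms fs) \<in> Hom D \<Theta> [n]"
    by (rule Cmp_in_Hom[OF tup_in_Hom[OF fs] g])
  with g fs show "(\<Theta>, n, op_tm \<Theta> n (Cmp D \<Theta> ms [n] g (tup \<Theta> ms fs)),
      msub (zip ms (map2 (op_tm \<Theta>) ms fs)) (op_tm ms n g)) \<in> Axioms (internal_language D T)"
    unfolding internal_language_def homs_def presentation.simps by (intro UnI2) blast
qed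

text \<open>Congruence replaces \<open>t\<close> and the \<open>ss\<close> by terms
  \<open>op_tm\<close>, and then the composition axiom applies. As in the axiom,
  \<open>ss ! i\<close> may contain only the \<open>ms ! i\<close> variables bound at its
  place.\<close>

lemma rep_msub:
  assumes t: "rep ms n t g" and l: "length ss = length ms" "length fs = length ms"
    and s: "\<And>i. i < length ms \<Longrightarrow> rep \<Theta> (ms ! i) (ss ! i) (fs ! i)"
  shows "rep \<Theta> n (msub (zip ms ss) t) (Cmp D \<Theta> ms [n] g (tup \<Theta> ms fs))"
proof -
  let ?ts = "map2 (op_tm \<Theta>) ms fs"
  have g: "g \<in> Hom D ms [n]" and fs: "homs \<Theta> ms fs" using t s l by (auto simp: rep_def homs_def)
  have h: "Cmp D \<Theta> ms [n] g (tup \<Theta> ms fs) \<in> Hom D \<Theta> [n]"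
    by (rule Cmp_in_Hom[OF tup_in_Hom[OF fs] g])
  have "derives \<Theta> n (msub (zip ms ss) t) (msub (zip ms ?ts) (op_tm ms n g))"
    using t s l by (intro derivable_msub) (auto simp: rep_def)
  then show ?thesis using h Cmp_axiom[OF g fs] by (auto simp: rep_def intro: derivable.trans derivable.sym)
qed

text \<open>Metasubstitution does not reach the variables in \<open>op_tm\<close>. They are replaced
  by the closed terms \<open>us\<close> indirectly: putting \<open>q\<close> and \<open>us\<close>
  for the metavariables of \<open>app_tm n\<close> performs the substitution, and
  \<open>rep_embed\<close> represents \<open>app_tm n\<close>.\<close>

lemma rep_Op:
  assumes f: "f \<in> Hom D ms [n]" and l: "length ts = length ms" "length hs = length ms"
    and ts: "\<And>i. i < length ms \<Longrightarrow> rep \<Theta> (ms ! i) (ts ! i) (hs ! i)"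
    and l': "length us = n" "length es = n"
    and us: "\<And>j. j < n \<Longrightarrow> rep \<Theta> 0 (us ! j) (es ! j)"
  shows "rep \<Theta> 0 (Op (ms, n, f) (zip ms ts @ map (Pair 0) us))
    (app \<Theta> n (Cmp D \<Theta> ms [n] f (tup \<Theta> ms hs)) es)"
proof -
  define q where "q = Op (ms, n, f) (zip ms ts @ map (\<lambda>j. (0, Var j)) [0..<n])"
  define g where "g = Cmp D \<Theta> ms [n] f (tup \<Theta> ms hs)"
  define \<sigma> where "\<sigma> = (\<lambda>j. if j < n then us ! j else Var (j - n))"
  have q: "rep \<Theta> n q g"
    using rep_msub[OF rep_op_tm[OF f] l ts] msub_op_tm[OF l(1), of 0] by (simp add: q_def g_def)
  have "rep \<Theta> 0 (msub (zip (n # replicate n 0) (q # us)) (embed (app_tm n)))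
    (Cmp D \<Theta> (n # replicate n 0) [0] (farr T (n # replicate n 0) [0] [app_tm n])
      (tup \<Theta> (n # replicate n 0) (g # es)))"
    using q us l' by (intro rep_msub rep_embed wf_app_tm) (auto simp: nth_Cons' less_Suc_eq_0_disj)
  moreover have "msub (zip (n # replicate n 0) (q # us)) (embed (app_tm n)) = Op (ms, n, f) (zip ms ts @ map (Pair 0) us)"
  proof -
    have "map (msub (zip (n # replicate n 0) (q # us))) (map (\<lambda>j. MVar (Suc j) []) [0..<n]) = us"
      using l'(1) by (intro nth_equalityI) (simp_all add: inst_def)
    then have "msub (zip (n # replicate n 0) (q # us)) (embed (app_tm n)) = sub \<sigma> q"
      by (simp add: app_tm_def inst_def \<sigma>_def comp_def)
    \<comment> \<open>The \<open>ts ! i\<close> have only bound variables, so the substitution for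
      the free ones passes over them.\<close>
    moreover have "sub (lift_sub (ms ! i) \<sigma>) (ts ! i) = ts ! i" if "i < length ms" for i
      by (rule sub_id_on[OF rep_wf[OF ts[OF that]]]) simp
    then have "map (\<lambda>(k, t). (k, sub (lift_sub k \<sigma>) t)) (zip ms ts) = zip ms ts"
      using l(1) by (intro nth_equalityI) simp_all
    moreover have "map (\<lambda>j. (0, lift_sub 0 \<sigma> j)) [0..<n] = map (Pair 0) us"
      using l'(1) by (intro nth_equalityI) (simp_all add: \<sigma>_def)
    ultimately show ?thesis by (simp add: q_def comp_def del: map_eq_conv)
  qed
  ultimately show ?thesis by (simp add: app_def act_def g_def)
qed

text \<open>By \<open>rep_Op\<close> and \<open>app_lam_vars\<close>, \<open>t\<close> is the operator of the abstraction applied to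
  metavariables of arity 0. Replacing these by variables turns it into \<open>op_tm\<close> of the abstraction. The metavariables are matched with the
  variables in reverse, following \<open>var\<close>.\<close>

lemma rep_lam:
  assumes t: "rep (\<Theta> @ replicate n 0) 0 t h"
  shows "rep \<Theta> n (msub (zip (\<Theta> @ replicate n 0)
    (map (\<lambda>i. eta_mvar i (\<Theta> ! i)) [0..<length \<Theta>] @ rev (map Var [0..<n]))) t) (lam \<Theta> n h)"
proof -
  let ?\<Theta> = "\<Theta> @ replicate n 0"
  define f where "f = lam \<Theta> n h"
  define es :: "(nat list \<times> nat \<times> 'a) tm list" where "es = map (\<lambda>i. eta_mvar i (\<Theta> ! i)) [0..<length \<Theta>]"
  define us :: "(nat list \<times> nat \<times> 'a) tm list" where "us = map (\<lambda>j. MVar (length \<Theta> + (n - Suc j)) []) [0..<n]"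
  define o' where "o' = Op (\<Theta>, n, f) (zip \<Theta> es @ map (Pair 0) us)"
  define ss :: "(nat list \<times> nat \<times> 'a) tm list" where "ss = es @ rev (map Var [0..<n])"
  have h: "h \<in> Hom D ?\<Theta> [0]" using t by (simp add: rep_def)
  have f: "f \<in> Hom D \<Theta> [n]" unfolding f_def by (rule lam_in_Hom[OF h])
  have "rep ?\<Theta> 0 o' (app ?\<Theta> n (Cmp D ?\<Theta> \<Theta> [n] f (tup ?\<Theta> \<Theta> (map (proj ?\<Theta>) [0..<length \<Theta>]))) (map (var \<Theta> n) [0..<n]))"
    unfolding o'_def
  proof (rule rep_Op[OF f])
    show "rep ?\<Theta> (\<Theta> ! i) (es ! i) (map (proj ?\<Theta>) [0..<length \<Theta>] ! i)" if "i < length \<Theta>" for i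
      using that by (simp add: es_def) (rule rep_eta_mvar, simp_all add: nth_append)
    show "rep ?\<Theta> 0 (us ! j) (map (var \<Theta> n) [0..<n] ! j)" if "j < n" for j
    proof -
      have "?\<Theta> ! (length \<Theta> + (n - Suc j)) = 0" using that by (auto simp: nth_append)
      then show ?thesis
        using that rep_eta_mvar[of "length \<Theta> + (n - Suc j)" ?\<Theta> 0]
        by (simp add: us_def var_def eta_mvar_def)
    qed
  qed (simp_all add: es_def us_def)
  moreover have "tup ?\<Theta> \<Theta> (map (proj ?\<Theta>) [0..<length \<Theta>]) = wkn \<Theta> n"
  proof -
    have "map (proj ?\<Theta>) [0..<length \<Theta>] =
      map (\<lambda>i. Cmp D ?\<Theta> \<Theta> [\<Theta> ! i] (proj \<Theta> i) (wkn \<Theta> n)) [0..<length \<Theta>]"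
      by (simp add: proj_wkn)
    then show ?thesis using tup_proj[OF wkn_in_Hom[of \<Theta> n]] by (simp only:)
  qed
  ultimately have o': "rep ?\<Theta> 0 o' h" by (simp add: f_def app_lam_vars[OF h])
  have nth: "zip ?\<Theta> ss ! i = (\<Theta> ! i, eta_mvar i (\<Theta> ! i))" if "i < length \<Theta>" for i
    using that by (simp add: ss_def es_def nth_append)
  have nth': "zip ?\<Theta> ss ! (length \<Theta> + (n - Suc j)) = (0, Var j)" if "j < n" for j
    using that by (auto simp: ss_def es_def nth_append rev_nth)
  have l: "length ss = length ?\<Theta>" by (simp add: ss_def es_def)
  have "derives ?\<Theta> 0 t o'" using t o' by (auto simp: rep_def intro: derivable.trans derivable.sym)
  moreover have "wf_il \<Theta> (n + ?\<Theta> ! i) (ss ! i)" if "i < length ?\<Theta>" for i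
    using that by (auto simp: ss_def es_def nth_append rev_nth intro!: wf_eta_mvar wf_tm.wf_Var)
  \<comment> \<open>The rule is applied with empty \<Gamma> and with \<Delta> of length
    \<open>n\<close>. Since \<open>t\<close> and \<open>o'\<close> are closed, their weakening does
    nothing; the variables enter through the terms put for the metavariables.\<close>
  ultimately have "derives \<Theta> (0 + n) (msub (zip ?\<Theta> ss) (ren (\<lambda>j. j + n) t)) (msub (zip ?\<Theta> ss) (ren (\<lambda>j. j + n) o'))"
    using l by (intro derivable.msubst) (auto intro: derivable.refl)
  then have "derives \<Theta> n (msub (zip ?\<Theta> ss) t) (msub (zip ?\<Theta> ss) o')"
    using rep_wf[OF t] rep_wf[OF o'] by simp
  moreover have "msub (zip ?\<Theta> ss) o' = op_tm \<Theta> n f"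
  proof -
    have "msub (map (weaken_abs (\<Theta> ! i)) (zip ?\<Theta> ss)) (eta_mvar i (\<Theta> ! i)) = eta_mvar i (\<Theta> ! i)"
      if "i < length \<Theta>" for i
      unfolding eta_mvar_def[of i "\<Theta> ! i"] using that nth[OF that] l by (simp add: comp_def) (simp add: eta_mvar_def)
    then have "map (\<lambda>(k, t). (k, msub (map (weaken_abs k) (zip ?\<Theta> ss)) t)) (zip \<Theta> es) =
      map (\<lambda>i. (\<Theta> ! i, eta_mvar i (\<Theta> ! i))) [0..<length \<Theta>]"
      by (intro nth_equalityI) (simp_all add: es_def)
    \<comment> \<open>The reversed numbering in \<open>us\<close> meets the reversed list in
      \<open>ss\<close>, hence \<open>Var j\<close> again.\<close>
    moreover have "msub (map (weaken_abs 0) (zip ?\<Theta> ss)) (us ! j) = Var j" if "j < n" for j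
      using that nth'[OF that] l by (simp add: us_def) (simp add: weaken_abs_def inst_def)
    then have "map (\<lambda>t. (0, msub (map (weaken_abs 0) (zip ?\<Theta> ss)) t)) us = map (\<lambda>j. (0, Var j)) [0..<n]"
      by (intro nth_equalityI) (simp_all add: us_def)
    ultimately show ?thesis by (simp add: o'_def op_tm_def comp_def del: map_eq_conv)
  qed
  ultimately show ?thesis using f by (simp add: rep_def f_def ss_def es_def)
qed

text \<open>In both inductive cases a generic term is represented first, and the subterms are then
  put for its metavariables by \<open>rep_msub\<close>. As \<open>rep_msub\<close> admits no other
  variables, the arity of each such metavariable counts all variables in scope at its place.\<close>

lemma rep_complete:
  assumes "wf_il \<Theta> n t"
  shows "\<exists>f. rep \<Theta> n t f"
  using assms
proof (induction rule: wf_tm.induct)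
  case (wf_Var i n)
  then show ?case using rep_embed[OF wf_tm.wf_Var[of i n]] by auto
next
  case (wf_MVar l ss n)
  then obtain h where h: "\<And>s. s \<in> set ss \<Longrightarrow> rep \<Theta> n s (h s)" by metis
  let ?\<Psi> = "\<Theta> @ replicate (length ss) n" and ?k = "length \<Theta>"
  let ?es = "map (\<lambda>i. eta_mvar i (\<Theta> ! i)) [0..<?k]"
  define s :: "unit tm" where "s = MVar l (map (\<lambda>j. eta_mvar (?k + j) n) [0..<length ss])"
  have "wf_tm empty_sig ?\<Psi> n s"
    using wf_MVar by (auto simp: s_def nth_append intro!: wf_tm.wf_MVar wf_eta_mvar)
  then have "rep \<Theta> n (msub (zip ?\<Psi> (?es @ ss)) (embed s))
    (Cmp D \<Theta> ?\<Psi> [n] (farr T ?\<Psi> [n] [s]) (tup \<Theta> ?\<Psi> (map (proj \<Theta>) [0..<?k] @ map h ss)))"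
    by (intro rep_msub rep_embed) (auto simp: nth_append h intro!: rep_eta_mvar)
  moreover have "msub (zip ?\<Psi> (?es @ ss)) (embed s) = MVar l ss"
  proof -
    have "msub (zip ?\<Psi> (?es @ ss)) (eta_mvar (?k + j) n) = ss ! j" if j: "j < length ss" for j
    proof -
      have "wf_il \<Theta> n (ss ! j)" using wf_MVar.IH j nth_mem by blast
      then show ?thesis using j by (simp add: eta_mvar_def comp_def nth_append)
    qed
    then have "map (\<lambda>j. msub (zip ?\<Psi> (?es @ ss)) (eta_mvar (?k + j) n)) [0..<length ss] = ss"
      by (intro nth_equalityI) simp_all
    then show ?thesis using wf_MVar.hyps by (simp add: s_def comp_def nth_append)
  qed
  ultimately show ?case by auto
next
  case (wf_Op c bs n)
  obtain ms p f where c: "c = (ms, p, f)" by (cases c)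
  define W where "W = ms @ replicate p 0"
  have f: "f \<in> Hom D ms [p]" and W: "map fst bs = W" using wf_Op.hyps c by (simp_all add: W_def)
  define k where "k = length W"
  have l: "length bs = k" using W by (simp add: k_def flip: W)
  have km: "k = length ms + p" by (simp add: k_def W_def)
  define ts where "ts = map snd bs"
  have bs: "bs ! i = (W ! i, ts ! i)" "fst (bs ! i) = W ! i" if "i < k" for i
    using that l by (simp_all add: ts_def flip: W)
  have "\<exists>g. rep \<Theta> (n + W ! i) (ts ! i) g" if "i < k" for i
    using wf_Op.IH that l bs by (metis nth_mem)
  then obtain g where g: "\<And>i. i < k \<Longrightarrow> rep \<Theta> (n + W ! i) (ts ! i) (g i)" by metis
  define W' where "W' = map ((+) n) W"
  have W': "length W' = k" "\<And>i. i < k \<Longrightarrow> W' ! i = n + W ! i" by (simp_all add: W'_def k_def)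
  define Y where "Y = W' @ replicate n 0"
  \<comment> \<open>These stand for the free variables, in the reversed order that
    \<open>rep_lam\<close> expects.\<close>
  define ys :: "unit tm list" where "ys = map (\<lambda>j. MVar (k + (n - Suc j)) []) [0..<n]"
  define q where "q i = MVar i (map Var [0..<W ! i] @ ys)" for i
  have q: "wf_tm empty_sig Y (W ! i) (q i)" if "i < k" for i
    using that W' by (auto simp: q_def ys_def Y_def nth_append intro!: wf_tm.intros)
  \<comment> \<open>A closed term, hence within reach of \<open>rep_Op\<close>; its arguments
    \<open>q i\<close> contain no operators and are represented by \<open>rep_embed\<close>.\<close>
  define E where "E = Op c (map (\<lambda>i. (W ! i, embed (q i))) [0..<k])"
  obtain H where H: "rep Y 0 E H"
  proof -
    let ?eq = "\<lambda>i. embed (q i)" and ?aq = "\<lambda>i. farr T Y [W ! i] [q i]"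
    have "rep Y 0 (Op (ms, p, f) (zip ms (map ?eq [0..<length ms]) @ map (Pair 0) (map (\<lambda>j. ?eq (length ms + j)) [0..<p])))
      (app Y p (Cmp D Y ms [p] f (tup Y ms (map ?aq [0..<length ms]))) (map (\<lambda>j. ?aq (length ms + j)) [0..<p]))"
    proof (rule rep_Op[OF f])
      show "rep Y (ms ! i) (map ?eq [0..<length ms] ! i) (map ?aq [0..<length ms] ! i)" if "i < length ms" for i
        using that rep_embed[OF q[of i]] by (simp add: km W_def nth_append)
      show "rep Y 0 (map (\<lambda>j. ?eq (length ms + j)) [0..<p] ! j) (map (\<lambda>j. ?aq (length ms + j)) [0..<p] ! j)" if "j < p" for j
        using that rep_embed[OF q[of "length ms + j"]] by (simp add: km W_def nth_append)
    qed simp_all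
    moreover have "E = Op (ms, p, f) (zip ms (map ?eq [0..<length ms]) @ map (Pair 0) (map (\<lambda>j. ?eq (length ms + j)) [0..<p]))"
      by (auto simp: E_def c W_def km nth_append intro!: nth_equalityI)
    ultimately show thesis using that by simp
  qed
  define es :: "(nat list \<times> nat \<times> 'a) tm list" where "es = map (\<lambda>i. eta_mvar i (W' ! i)) [0..<length W'] @ rev (map Var [0..<n])"
  \<comment> \<open>The result of restoring the free variables in \<open>E\<close>: the operator
    with each argument a metavariable applied to all variables in scope.\<close>
  define S where "S = Op c (map (\<lambda>i. (W ! i, eta_mvar i (n + W ! i))) [0..<k]) "
  have "msub (zip Y es) E = S"
  proof -
    have "msub (map (weaken_abs (W ! i)) (zip Y es)) (embed (q i)) = eta_mvar i (n + W ! i)" if i: "i < k" for i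
    proof -
      let ?\<tau> = "map (weaken_abs (W ! i)) (zip Y es)"
      have le: "length es = k + n" "length Y = k + n" using W' by (simp_all add: es_def Y_def)
      have "zip Y es ! (k + (n - Suc j)) = (0, Var j)" if "j < n" for j
        using that W' le by (auto simp: es_def Y_def nth_append rev_nth)
      \<comment> \<open>Under the binder the free variables are shifted by \<open>W ! i\<close>,
        just past the bound ones; together they list all variables in scope.\<close>
      then have "?\<tau> ! (k + (n - Suc j)) = (0, Var (j + W ! i))" if "j < n" for j
        using that le by (simp add: weaken_abs_def)
      then have y: "map (msub ?\<tau>) (map embed ys) = map (\<lambda>j. Var (j + W ! i)) [0..<n]"
        by (intro nth_equalityI) (simp_all add: ys_def inst_def)
      have "zip Y es ! i = (n + W ! i, eta_mvar i (n + W ! i))"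
        using i W' le by (simp add: es_def Y_def nth_append)
      then have "?\<tau> ! i = (n + W ! i, eta_mvar i (n + W ! i))"
        using i le by (simp add: weaken_abs_def)
      moreover have "map Var [0..<W ! i] @ map (\<lambda>j. Var (j + W ! i)) [0..<n] =
          (map Var [0..<n + W ! i] :: (nat list \<times> nat \<times> 'a) tm list)"
        by (intro nth_equalityI) (auto simp: nth_append)
      moreover have "map (msub ?\<tau>) (map embed (map Var [0..<W ! i] @ ys)) =
          map Var [0..<W ! i] @ map (\<lambda>j. Var (j + W ! i)) [0..<n]"
        unfolding map_append y by simp
      ultimately have "msub ?\<tau> (embed (q i)) = inst (n + W ! i, eta_mvar i (n + W ! i)) (map Var [0..<n + W ! i])"
        unfolding q_def embed_simps msub.simps by (simp only:)
      then show ?thesis by (simp only: inst_eta_mvar length_map length_upt diff_zero) (simp add: eta_mvar_def)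
    qed
    then show ?thesis by (simp add: E_def S_def)
  qed
  with rep_lam[of W' n E H] H have S: "rep W' n S (lam W' n H)" by (simp add: Y_def es_def)
  have "rep \<Theta> n (msub (zip W' ts) S) (Cmp D \<Theta> W' [n] (lam W' n H) (tup \<Theta> W' (map g [0..<k])))"
    using S l g W' by (intro rep_msub) (auto simp: ts_def)
  moreover have "msub (zip W' ts) S = Op c bs"
  proof -
    have "msub (map (weaken_abs (W ! i)) (zip W' ts)) (eta_mvar i (n + W ! i)) = ts ! i" if "i < k" for i
    proof -
      have "map (weaken_abs (W ! i)) (zip W' ts) ! i = weaken_abs (W ! i) (n + W ! i, ts ! i)"
        using that W' l by (simp add: ts_def)
      then show ?thesis
        using inst_weaken_abs_Vars[OF rep_wf[OF g[OF that]], of "W ! i"]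
        by (simp add: eta_mvar_def comp_def)
    qed
    then show ?thesis using bs l by (auto simp: S_def intro!: nth_equalityI)
  qed
  ultimately show ?case by auto
qed

end

section \<open>Transport of structure\<close>

text \<open>\<open>C'\<close> is raw data compared with the category \<open>C\<close>; that it
  satisfies the laws of a cartesian category is a conclusion.\<close>

locale ccat_iso = C: cartesian_category C
  for C :: "('o, 'a, 'z) ccat_scheme" and C' :: "('o, 'b, 'y) ccat_scheme"
    and \<phi> :: "'o \<Rightarrow> 'o \<Rightarrow> 'a \<Rightarrow> 'b" +
  assumes Obj_eq: "Obj C' = Obj C"
    and One_eq: "One C' = One C"
    and Prod_eq: "Prod C' = Prod C"
    and bij: "\<lbrakk>A \<in> Obj C; B \<in> Obj C\<rbrakk> \<Longrightarrow> bij_betw (\<phi> A B) (Hom C A B) (Hom C' A B)"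
    and \<phi>_Id: "A \<in> Obj C \<Longrightarrow> \<phi> A A (Id C A) = Id C' A"
    and \<phi>_Cmp: "\<lbrakk>A \<in> Obj C; B \<in> Obj C; E \<in> Obj C; f \<in> Hom C A B; g \<in> Hom C B E\<rbrakk>
      \<Longrightarrow> \<phi> A E (Cmp C A B E g f) = Cmp C' A B E (\<phi> B E g) (\<phi> A B f)"
    and \<phi>_Fst: "\<lbrakk>A \<in> Obj C; B \<in> Obj C\<rbrakk> \<Longrightarrow> \<phi> (Prod C A B) A (Fst C A B) = Fst C' A B"
    and \<phi>_Snd: "\<lbrakk>A \<in> Obj C; B \<in> Obj C\<rbrakk> \<Longrightarrow> \<phi> (Prod C A B) B (Snd C A B) = Snd C' A B"
begin

lemma \<phi>_in_Hom: "\<lbrakk>A \<in> Obj C; B \<in> Obj C; f \<in> Hom C A B\<rbrakk> \<Longrightarrow> \<phi> A B f \<in> Hom C' A B"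
  using bij bij_betwE by blast

lemma \<phi>_eq_iff:
  "\<lbrakk>A \<in> Obj C; B \<in> Obj C; f \<in> Hom C A B; g \<in> Hom C A B\<rbrakk> \<Longrightarrow> \<phi> A B f = \<phi> A B g \<longleftrightarrow> f = g"
  using bij by (metis bij_betw_def inj_on_eq_iff)

lemma HomE:
  assumes "f' \<in> Hom C' A B" "A \<in> Obj C" "B \<in> Obj C"
  obtains f where "f \<in> Hom C A B" "f' = \<phi> A B f"
  using assms bij by (metis bij_betw_imp_surj_on imageE)

text \<open>Terminal object, products and exponentials are all stated as unique existence in a
  hom-set, so this one transfer serves for each.\<close>

lemma ex1_transport:
  assumes "\<exists>!h. h \<in> Hom C A B \<and> P h" "A \<in> Obj C" "B \<in> Obj C"
    and "\<And>h. h \<in> Hom C A B \<Longrightarrow> Q (\<phi> A B h) \<longleftrightarrow> P h"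
  shows "\<exists>!h'. h' \<in> Hom C' A B \<and> Q h'"
proof -
  obtain h where h: "h \<in> Hom C A B" "P h" and uniq: "\<And>g. g \<in> Hom C A B \<Longrightarrow> P g \<Longrightarrow> g = h"
    using assms(1) by auto
  show ?thesis
  proof (rule ex1I[of _ "\<phi> A B h"])
    show "\<phi> A B h \<in> Hom C' A B \<and> Q (\<phi> A B h)" using h assms \<phi>_in_Hom by blast
    fix h' assume "h' \<in> Hom C' A B \<and> Q h'"
    then show "h' = \<phi> A B h" using assms uniq by (metis HomE)
  qed
qed

sublocale C': cartesian_category C'
proof
  show "Id C' A \<in> Hom C' A A" if "A \<in> Obj C'" for A
    using that C.Id_in_Hom[of A] \<phi>_in_Hom[of A A] by (simp add: Obj_eq \<phi>_Id[symmetric])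
  show "Cmp C' A B E g f \<in> Hom C' A E"
    if "A \<in> Obj C'" "B \<in> Obj C'" "E \<in> Obj C'" "f \<in> Hom C' A B" "g \<in> Hom C' B E" for A B E f g
    using that unfolding Obj_eq
    by (metis C.Cmp_in_Hom HomE \<phi>_Cmp \<phi>_in_Hom)
  show "Cmp C' A A B f (Id C' A) = f" if "A \<in> Obj C'" "B \<in> Obj C'" "f \<in> Hom C' A B" for A B f
    using that unfolding Obj_eq by (metis C.Cmp_Id_right C.Id_in_Hom HomE \<phi>_Cmp \<phi>_Id)
  show "Cmp C' A B B (Id C' B) f = f" if "A \<in> Obj C'" "B \<in> Obj C'" "f \<in> Hom C' A B" for A B f
    using that unfolding Obj_eq by (metis C.Cmp_Id_left C.Id_in_Hom HomE \<phi>_Cmp \<phi>_Id)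
  show "Cmp C' A D E h (Cmp C' A B D g f) = Cmp C' A B E (Cmp C' B D E h g) f"
    if obj: "A \<in> Obj C'" "B \<in> Obj C'" "D \<in> Obj C'" "E \<in> Obj C'"
      and arr: "f \<in> Hom C' A B" "g \<in> Hom C' B D" "h \<in> Hom C' D E" for A B D E f g h
  proof -
    note obj = obj[unfolded Obj_eq]
    obtain f0 g0 h0 where "f0 \<in> Hom C A B" "f = \<phi> A B f0" "g0 \<in> Hom C B D" "g = \<phi> B D g0"
      "h0 \<in> Hom C D E" "h = \<phi> D E h0"
      using arr obj by (metis HomE)
    then show ?thesis using obj by (simp add: \<phi>_Cmp[symmetric] C.Cmp_in_Hom C.Cmp_assoc)
  qed
  show "One C' \<in> Obj C'" by (simp add: One_eq Obj_eq C.One_Obj)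
  show "\<exists>!f. f \<in> Hom C' A (One C')" if "A \<in> Obj C'" for A
    using that ex1_transport[of A "One C" "\<lambda>_. True" "\<lambda>_. True"] C.One_terminal[of A]
    by (simp add: Obj_eq One_eq C.One_Obj)
  show "Prod C' A B \<in> Obj C'" if "A \<in> Obj C'" "B \<in> Obj C'" for A B
    using that by (simp add: Obj_eq Prod_eq C.Prod_Obj)
  show "Fst C' A B \<in> Hom C' (Prod C' A B) A" if "A \<in> Obj C'" "B \<in> Obj C'" for A B
    using that by (simp add: Obj_eq Prod_eq \<phi>_Fst[symmetric] C.Fst_in_Hom \<phi>_in_Hom C.Prod_Obj)
  show "Snd C' A B \<in> Hom C' (Prod C' A B) B" if "A \<in> Obj C'" "B \<in> Obj C'" for A B
    using that by (simp add: Obj_eq Prod_eq \<phi>_Snd[symmetric] C.Snd_in_Hom \<phi>_in_Hom C.Prod_Obj)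
  show "\<exists>!h. h \<in> Hom C' X (Prod C' A B) \<and> Cmp C' X (Prod C' A B) A (Fst C' A B) h = f \<and>
      Cmp C' X (Prod C' A B) B (Snd C' A B) h = g"
    if obj: "X \<in> Obj C'" "A \<in> Obj C'" "B \<in> Obj C'" and arr: "f \<in> Hom C' X A" "g \<in> Hom C' X B"
    for X A B f g
  proof -
    note obj = obj[unfolded Obj_eq]
    obtain f0 g0 where fg: "f0 \<in> Hom C X A" "f = \<phi> X A f0" "g0 \<in> Hom C X B" "g = \<phi> X B g0"
      using arr obj by (metis HomE)
    show ?thesis unfolding Prod_eq
    proof (rule ex1_transport[OF C.Prod_universal[OF obj fg(1,3)] obj(1) C.Prod_Obj[OF obj(2,3)]])
      fix h assume "h \<in> Hom C X (Prod C A B)"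
      then show "Cmp C' X (Prod C A B) A (Fst C' A B) (\<phi> X (Prod C A B) h) = f \<and>
          Cmp C' X (Prod C A B) B (Snd C' A B) (\<phi> X (Prod C A B) h) = g \<longleftrightarrow>
        Cmp C X (Prod C A B) A (Fst C A B) h = f0 \<and> Cmp C X (Prod C A B) B (Snd C A B) h = g0"
        using obj fg C.Prod_Obj C.Fst_in_Hom C.Snd_in_Hom
        by (simp add: \<phi>_Fst[symmetric] \<phi>_Snd[symmetric] \<phi>_Cmp[symmetric] C.Cmp_in_Hom \<phi>_eq_iff)
    qed
  qed
qed

lemma
  assumes obj: "X \<in> Obj C" "A \<in> Obj C" "B \<in> Obj C" and fg: "f \<in> Hom C X A" "g \<in> Hom C X B"
  shows pairing_in_Hom: "pairing C X A B f g \<in> Hom C X (Prod C A B)"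
    and \<phi>_pairing: "\<phi> X (Prod C A B) (pairing C X A B f g) = pairing C' X A B (\<phi> X A f) (\<phi> X B g)"
proof -
  note p = theI'[OF C.Prod_universal[OF obj fg], folded pairing_def]
  then show "pairing C X A B f g \<in> Hom C X (Prod C A B)" by blast
  show "\<phi> X (Prod C A B) (pairing C X A B f g) = pairing C' X A B (\<phi> X A f) (\<phi> X B g)"
    unfolding pairing_def[of C']
  proof (rule the1_equality[symmetric])
    show "\<exists>!h. h \<in> Hom C' X (Prod C' A B) \<and> Cmp C' X (Prod C' A B) A (Fst C' A B) h = \<phi> X A f \<and>
        Cmp C' X (Prod C' A B) B (Snd C' A B) h = \<phi> X B g"
      using obj fg by (intro C'.Prod_universal) (simp_all add: Obj_eq \<phi>_in_Hom)
    show "\<phi> X (Prod C A B) (pairing C X A B f g) \<in> Hom C' X (Prod C' A B) \<and>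
      Cmp C' X (Prod C' A B) A (Fst C' A B) (\<phi> X (Prod C A B) (pairing C X A B f g)) = \<phi> X A f \<and>
      Cmp C' X (Prod C' A B) B (Snd C' A B) (\<phi> X (Prod C A B) (pairing C X A B f g)) = \<phi> X B g"
      using p obj fg C.Prod_Obj C.Fst_in_Hom C.Snd_in_Hom
      by (simp add: Prod_eq \<phi>_in_Hom \<phi>_Fst[symmetric] \<phi>_Snd[symmetric] \<phi>_Cmp[symmetric])
  qed
qed

lemma is_exponential_transport:
  assumes "is_exponential C X A E ev"
  shows "is_exponential C' X A E (\<phi> (Prod C E X) A ev)"
proof -
  have obj: "X \<in> Obj C" "A \<in> Obj C" "E \<in> Obj C" and ev: "ev \<in> Hom C (Prod C E X) A"
    and ex1: "\<And>B f. B \<in> Obj C \<Longrightarrow> f \<in> Hom C (Prod C B X) A \<Longrightarrow> \<exists>!g. g \<in> Hom C B E \<and>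
      Cmp C (Prod C B X) (Prod C E X) A ev (pairing C (Prod C B X) E X
        (Cmp C (Prod C B X) B E g (Fst C B X)) (Snd C B X)) = f"
    using assms unfolding is_exponential_def by blast+
  have "\<exists>!g'. g' \<in> Hom C' B E \<and>
      Cmp C' (Prod C B X) (Prod C E X) A (\<phi> (Prod C E X) A ev) (pairing C' (Prod C B X) E X
        (Cmp C' (Prod C B X) B E g' (Fst C' B X)) (Snd C' B X)) = f'"
    if B: "B \<in> Obj C" and f': "f' \<in> Hom C' (Prod C B X) A" for B f'
  proof -
    obtain f where f: "f \<in> Hom C (Prod C B X) A" "f' = \<phi> (Prod C B X) A f"
      using f' HomE C.Prod_Obj obj B by metis
    show ?thesis
    proof (rule ex1_transport[OF ex1[OF B f(1)] B obj(3)])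
      fix g assume "g \<in> Hom C B E"
      then show "Cmp C' (Prod C B X) (Prod C E X) A (\<phi> (Prod C E X) A ev) (pairing C' (Prod C B X) E X
          (Cmp C' (Prod C B X) B E (\<phi> B E g) (Fst C' B X)) (Snd C' B X)) = f' \<longleftrightarrow>
        Cmp C (Prod C B X) (Prod C E X) A ev (pairing C (Prod C B X) E X
          (Cmp C (Prod C B X) B E g (Fst C B X)) (Snd C B X)) = f"
        using B obj ev f C.Prod_Obj C.Fst_in_Hom C.Snd_in_Hom
        by (simp add: \<phi>_Fst[symmetric] \<phi>_Snd[symmetric] \<phi>_Cmp[symmetric] \<phi>_pairing[symmetric]
            C.Cmp_in_Hom pairing_in_Hom \<phi>_eq_iff)
    qed
  qed
  then show ?thesis
    using obj ev by (simp add: is_exponential_def Obj_eq Prod_eq C.Prod_Obj \<phi>_in_Hom)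
qed

section \<open>The two mutually inverse functors\<close>

definition iso_func :: "('o, 'a, 'o, 'b) func" where
  "iso_func = \<lparr>fobj = (\<lambda>A. A), farr = \<phi>\<rparr>"

definition inv_func :: "('o, 'b, 'o, 'a) func" where
  "inv_func = \<lparr>fobj = (\<lambda>A. A), farr = (\<lambda>A B. inv_into (Hom C A B) (\<phi> A B))\<rparr>"

lemma cat_functor_iso: "cat_functor C C' iso_func"
  by unfold_locales (simp_all add: iso_func_def Obj_eq \<phi>_in_Hom \<phi>_Id \<phi>_Cmp)

lemma inv_into_\<phi>:
  "\<lbrakk>A \<in> Obj C; B \<in> Obj C; f \<in> Hom C A B\<rbrakk> \<Longrightarrow> inv_into (Hom C A B) (\<phi> A B) (\<phi> A B f) = f"
  using bij by (simp add: bij_betw_def)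

lemma cat_functor_inv: "cat_functor C' C inv_func"
proof unfold_locales
  show "farr inv_func A B f \<in> Hom C (fobj inv_func A) (fobj inv_func B)"
    if "A \<in> Obj C'" "B \<in> Obj C'" "f \<in> Hom C' A B" for A B f
    using that by (auto simp: inv_func_def Obj_eq inv_into_\<phi> elim!: HomE)
  show "farr inv_func A A (Id C' A) = Id C (fobj inv_func A)" if "A \<in> Obj C'" for A
    using that by (simp add: inv_func_def Obj_eq \<phi>_Id[symmetric] inv_into_\<phi> C.Id_in_Hom)
  show "farr inv_func A E (Cmp C' A B E g f) =
      Cmp C (fobj inv_func A) (fobj inv_func B) (fobj inv_func E) (farr inv_func B E g) (farr inv_func A B f)"
    if "A \<in> Obj C'" "B \<in> Obj C'" "E \<in> Obj C'" "f \<in> Hom C' A B" "g \<in> Hom C' B E" for A B E f g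
    using that by (auto simp: inv_func_def Obj_eq inv_into_\<phi> \<phi>_Cmp[symmetric] C.Cmp_in_Hom elim!: HomE)
qed (simp add: inv_func_def Obj_eq)

lemma
  shows inv_iso: "func_eq C (comp_func inv_func iso_func) id_func"
    and iso_inv: "func_eq C' (comp_func iso_func inv_func) id_func"
  by (auto simp: func_eq_def comp_func_def inv_func_def iso_func_def id_func_def Obj_eq inv_into_\<phi> elim!: HomE)

end

section \<open>Arrows of \<open>D\<close> as tuples of classes of terms\<close>

context second_order_theory
begin

definition cls :: "nat list \<Rightarrow> nat \<Rightarrow> 'a \<Rightarrow> (nat list \<times> nat \<times> 'a) tm set" where
  "cls \<Theta> n f = eq_class (internal_language D T) \<Theta> n (op_tm \<Theta> n f)"

definition cls_arr :: "nat list \<Rightarrow> nat list \<Rightarrow> 'a \<Rightarrow> (nat list \<times> nat \<times> 'a) tm set list" where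
  "cls_arr ms ns f = map (\<lambda>i. cls ms (ns ! i) (Cmp D ms ns [ns ! i] (proj ns i) f)) [0..<length ns]"

lemma mem_cls: "f \<in> Hom D \<Theta> [n] \<Longrightarrow> t \<in> cls \<Theta> n f \<longleftrightarrow> rep \<Theta> n t f"
  by (auto simp: cls_def eq_class_def rep_def intro: derivable.sym)

lemma rep_eq_class: "rep \<Theta> n t f \<Longrightarrow> eq_class (internal_language D T) \<Theta> n t = cls \<Theta> n f"
  by (auto simp: cls_def eq_class_def rep_def intro: derivable.trans derivable.sym)

lemma cls_inj: "f \<in> Hom D \<Theta> [n] \<Longrightarrow> g \<in> Hom D \<Theta> [n] \<Longrightarrow> cls \<Theta> n f = cls \<Theta> n g \<longleftrightarrow> f = g"
  by (metis derives_op_tm_inj mem_cls rep_def rep_op_tm)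

lemma proj_Cmp_in_Hom: "f \<in> Hom D ms ns \<Longrightarrow> i < length ns \<Longrightarrow> Cmp D ms ns [ns ! i] (proj ns i) f \<in> Hom D ms [ns ! i]"
  by (rule Cmp_in_Hom[OF _ proj_in_Hom]) simp_all

text \<open>Completeness enters here: by \<open>rep_complete\<close> every class of well-formed
  terms contains some \<open>op_tm\<close>.\<close>

lemma Hom_MM_of:
  "ts \<in> Hom (MM_of (internal_language D T)) ms ns \<longleftrightarrow>
    length ts = length ns \<and> (\<forall>i < length ns. \<exists>f \<in> Hom D ms [ns ! i]. ts ! i = cls ms (ns ! i) f)"
proof -
  have "(\<exists>t. wf_il ms n t \<and> A = eq_class (internal_language D T) ms n t) \<longleftrightarrow>
      (\<exists>f \<in> Hom D ms [n]. A = cls ms n f)" for n A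
    using rep_complete rep_eq_class wf_op_tm by (metis cls_def rep_def)
  then show ?thesis by (simp add: MM_of_def)
qed

lemma bij_cls_arr: "bij_betw (cls_arr ms ns) (Hom D ms ns) (Hom (MM_of (internal_language D T)) ms ns)"
  unfolding bij_betw_def
proof (intro conjI inj_onI subset_antisym subsetI)
  fix f g assume fg: "f \<in> Hom D ms ns" "g \<in> Hom D ms ns" "cls_arr ms ns f = cls_arr ms ns g"
  show "f = g"
  proof (rule tup_eqI[OF fg(1,2)])
    fix i assume i: "i < length ns"
    then have "cls_arr ms ns f ! i = cls_arr ms ns g ! i" using fg(3) by simp
    with i show "Cmp D ms ns [ns ! i] (proj ns i) f = Cmp D ms ns [ns ! i] (proj ns i) g"
      using fg by (simp add: cls_arr_def cls_inj proj_Cmp_in_Hom)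
  qed
next
  fix ts assume "ts \<in> cls_arr ms ns ` Hom D ms ns"
  then obtain f where f: "f \<in> Hom D ms ns" "ts = cls_arr ms ns f" by blast
  have "\<exists>g \<in> Hom D ms [ns ! i]. ts ! i = cls ms (ns ! i) g" if "i < length ns" for i
    using f that by (intro bexI[of _ "Cmp D ms ns [ns ! i] (proj ns i) f"]) (simp_all add: cls_arr_def proj_Cmp_in_Hom)
  then show "ts \<in> Hom (MM_of (internal_language D T)) ms ns"
    using f by (simp add: Hom_MM_of cls_arr_def)
next
  fix ts assume "ts \<in> Hom (MM_of (internal_language D T)) ms ns"
  then obtain f where f: "\<And>i. i < length ns \<Longrightarrow> f i \<in> Hom D ms [ns ! i] \<and> ts ! i = cls ms (ns ! i) (f i)"
    and l: "length ts = length ns"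
    unfolding Hom_MM_of by metis
  let ?p = "tup ms ns (map f [0..<length ns])"
  have h: "homs ms ns (map f [0..<length ns])" using f by (simp add: homs_map_upt)
  have "ts = cls_arr ms ns ?p"
    using f l by (intro nth_equalityI) (simp_all add: cls_arr_def proj_tup[OF h])
  then show "ts \<in> cls_arr ms ns ` Hom D ms ns" using tup_in_Hom[OF h] by blast
qed

text \<open>A component of the composite in \<open>MM_of\<close> is a union over all
  representatives. By \<open>rep_msub\<close> every choice yields a term represented by the same
  arrow, so all choices give one class.\<close>

lemma cls_arr_Cmp:
  assumes f: "f \<in> Hom D ls ms" and g: "g \<in> Hom D ms ns"
  shows "cls_arr ls ns (Cmp D ls ms ns g f) =
    Cmp (MM_of (internal_language D T)) ls ms ns (cls_arr ms ns g) (cls_arr ls ms f)"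
proof -
  have "{u. \<exists>t' \<in> cls ms n g'. \<exists>ss' \<in> listset (cls_arr ls ms f). derives ls n (msub (zip ms ss') t') u} =
      cls ls n (Cmp D ls ms [n] g' f)" (is "?A = _") if g': "g' \<in> Hom D ms [n]" for n g'
  proof -
    let ?f = "\<lambda>j. Cmp D ls ms [ms ! j] (proj ms j) f"
    have rep: "rep ls n (msub (zip ms ss) t) (Cmp D ls ms [n] g' f)"
      if "t \<in> cls ms n g'" "ss \<in> listset (cls_arr ls ms f)" for t ss
    proof -
      have "length ss = length ms" "\<And>j. j < length ms \<Longrightarrow> rep ls (ms ! j) (ss ! j) (?f j)"
        using that(2) f by (auto simp: listset_iff cls_arr_def mem_cls proj_Cmp_in_Hom)
      then have "rep ls n (msub (zip ms ss) t) (Cmp D ls ms [n] g' (tup ls ms (map ?f [0..<length ms])))"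
        using that(1) g' by (intro rep_msub) (auto simp: mem_cls)
      then show ?thesis by (simp add: tup_proj[OF f])
    qed
    then have A: "derives ls n (msub (zip ms ss) t) u \<longleftrightarrow> u \<in> cls ls n (Cmp D ls ms [n] g' f)"
      if "t \<in> cls ms n g'" "ss \<in> listset (cls_arr ls ms f)" for t ss u
      using rep_eq_class[OF rep[OF that]] by (auto simp: eq_class_def)
    \<comment> \<open>At least one choice of representatives exists, so the union is not
      empty.\<close>
    have "op_tm ms n g' \<in> cls ms n g'" using g' by (simp add: mem_cls rep_op_tm)
    moreover have "map (\<lambda>j. op_tm ls (ms ! j) (?f j)) [0..<length ms] \<in> listset (cls_arr ls ms f)"
      using f by (simp add: listset_iff cls_arr_def mem_cls proj_Cmp_in_Hom rep_op_tm)
    ultimately show ?thesis using A by blast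
  qed
  then show ?thesis
    using f g by (auto simp: MM_of_def cls_arr_def[of _ ns] proj_Cmp_in_Hom Cmp_assoc[OF f g proj_in_Hom]
        intro!: nth_equalityI)
qed

lemma cls_arr_farr:
  assumes "ts \<in> Hom MM ms ns"
  shows "cls_arr ms ns (farr T ms ns ts) = canonical_arr (internal_language D T) ms ns ts"
proof -
  have "eq_class (internal_language D T) ms (ns ! i) (embed (ts ! i)) =
      cls ms (ns ! i) (farr T ms [ns ! i] [ts ! i])" if "i < length ns" for i
    using assms that by (intro rep_eq_class rep_embed) (simp add: Hom_MM_iff)
  then show ?thesis
    using assms by (auto simp: cls_arr_def canonical_arr_def proj_farr Hom_MM_iff intro!: nth_equalityI)
qed

sublocale iso: ccat_iso D "MM_of (internal_language D T)" cls_arr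
proof
  have F: "Fst MM ms ns \<in> Hom MM (ms @ ns) ms" and S: "Snd MM ms ns \<in> Hom MM (ms @ ns) ns"
    and I: "Id MM ms \<in> Hom MM ms ms" for ms ns
    using T.dom.Fst_in_Hom[of ms ns] T.dom.Snd_in_Hom[of ms ns] T.dom.Id_in_Hom[of ms] by simp_all
  show "cls_arr A A (Id D A) = Id (MM_of (internal_language D T)) A" for A
    using cls_arr_farr[OF I[of A]] by (simp add: farr_Id MM_of_def)
  show "cls_arr (Prod D A B) A (Fst D A B) = Fst (MM_of (internal_language D T)) A B" for A B
    using cls_arr_farr[OF F[of A B]] by (simp add: farr_Fst MM_of_def)
  show "cls_arr (Prod D A B) B (Snd D A B) = Snd (MM_of (internal_language D T)) A B" for A B
    using cls_arr_farr[OF S[of A B]] by (simp add: farr_Snd MM_of_def)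
qed (simp_all add: bij_cls_arr cls_arr_Cmp, simp_all add: MM_of_def fun_eq_iff)

text \<open>On arrows of \<open>MM\<close> the canonical functor is \<open>cls_arr\<close> after
  \<open>T\<close>, so its compatibility with composition and with exponentials comes from
  \<open>T\<close> by transport along \<open>cls_arr\<close>.\<close>

lemma soat_canonical: "soat (MM_of (internal_language D T)) (canonical (internal_language D T))"
proof -
  let ?P = "internal_language D T"
  have arr: "farr (canonical ?P) ms ns ts = cls_arr ms ns (farr T ms ns ts)" if "ts \<in> Hom MM ms ns" for ms ns ts
    using cls_arr_farr[OF that] by (simp add: canonical_def)
  have obj [simp]: "fobj (canonical ?P) ms = ms" for ms by (simp add: canonical_def)
  have [simp]: "Obj (MM_of ?P) = UNIV" "One (MM_of ?P) = []" "Prod (MM_of ?P) ms ns = ms @ ns" for ms ns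
    by (simp_all add: MM_of_def)
  have "strict_cartesian_functor MM (MM_of ?P) (canonical ?P)"
  proof unfold_locales
    show "farr (canonical ?P) A B f \<in> Hom (MM_of ?P) (fobj (canonical ?P) A) (fobj (canonical ?P) B)"
      if "f \<in> Hom MM A B" for A B f
      using that iso.\<phi>_in_Hom[of A B] by (simp add: arr farr_in_Hom)
    show "farr (canonical ?P) A E (Cmp MM A B E g f) =
        Cmp (MM_of ?P) (fobj (canonical ?P) A) (fobj (canonical ?P) B) (fobj (canonical ?P) E)
          (farr (canonical ?P) B E g) (farr (canonical ?P) A B f)"
      if "f \<in> Hom MM A B" "g \<in> Hom MM B E" for A B E f g
      using that T.dom.Cmp_in_Hom[of A B E f g] T.farr_Cmp[of A B E f g]
      by (simp add: arr cls_arr_Cmp farr_in_Hom del: MM_simps(2))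
  qed (simp_all add: canonical_def MM_of_def)
  moreover have "preserves_MM_exponentials (MM_of ?P) (canonical ?P)"
    unfolding preserves_MM_exponentials_def
  proof
    fix ms
    have e: "is_exponential D [0] ms (MM_exp ms) (farr T (MM_exp ms @ [0]) ms (MM_ev ms))"
      using soat by (simp add: soat_def preserves_MM_exponentials_def)
    have "MM_ev ms \<in> Hom MM (MM_exp ms @ [0]) ms"
      by (auto simp: Hom_MM_iff MM_ev_def MM_exp_def nth_append intro!: wf_tm.intros)
    with iso.is_exponential_transport[OF e]
    show "is_exponential (MM_of ?P) (fobj (canonical ?P) [0]) (fobj (canonical ?P) ms)
        (fobj (canonical ?P) (MM_exp ms))
        (farr (canonical ?P) (Prod MM (MM_exp ms) [0]) ms (MM_ev ms))"
      by (simp add: arr)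
  qed
  ultimately show ?thesis by (simp add: soat_def identity_on_objects_def)
qed

end

theorem theorem1:
  fixes D :: "(nat list, 'a) ccat"
    and T :: "(nat list, unit tm list, nat list, 'a) func"
  assumes "soat D T"
  shows "soat_isomorphic D T (MM_of (internal_language D T)) (canonical (internal_language D T))"
proof -
  interpret second_order_theory D T by unfold_locales (rule assms)
  let ?P = "internal_language D T"
  have "func_eq MM (canonical ?P) (comp_func iso.iso_func T)"
    by (simp add: func_eq_def comp_func_def iso.iso_func_def canonical_def cls_arr_farr)
  moreover have "func_eq MM T (comp_func iso.inv_func (canonical ?P))"
    using iso.inv_into_\<phi>
    by (simp add: func_eq_def comp_func_def iso.inv_func_def canonical_def cls_arr_farr[symmetric] farr_in_Hom)
  ultimately show ?thesis
    unfolding soat_isomorphic_def algebraic_translation_def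
    using soat soat_canonical iso.cat_functor_iso iso.cat_functor_inv iso.inv_iso iso.iso_inv by blast
qed

end
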